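(* Let $U$ be an open subset of $X$ and suppose that the map $F:U\to L^2(\Omega)$ is continuously differentiable (with respect to the norm of $X$) and that for every $\varphi\in U$ the derivative $DF(\varphi)\in L_c(X;L^2(\Omega))$ has an extension $D_eF(\varphi)$ which belongs to $L_c(X_0;L^2(\Omega))$. If the set $$X_F=\{\varphi\in U:\ \dot\varphi(0)+A\varphi(0)=F(\varphi)\}$$ is nonempty, then $X_F$ is a $C^1$ submanifold of $X$.
   Context: $\Omega\subset\mathbb{R}^n$ is a domain and $h>0$. Standing assumptions: $-A$ generates a compact analytic $C_0$-semigroup $\{e^{-At}\}_{t\ge0}$ on $L^2(\Omega)$; $F(\varphi)=B(\varphi(-r(\varphi)))$ for $\varphi\in C([-h,0];L^2(\Omega))$, where $B:L^2(\Omega)\to L^2(\Omega)$ is bounded (maps bounded sets to bounded sets) and Lipschitz, and $r:C([-h,0];L^2(\Omega))\to[0,h]$ is Lipschitz. $X=\{\varphi\in C^1([-h,0];L^2(\Omega)):\varphi(0)\in D(A)\}$ is the Banach space with norm $\|\varphi\|_X=\max_{\theta\in[-h,0]}\|\varphi(\theta)\|+\max_{\theta\in[-h,0]}\|\dot\varphi(\theta)\|+\|A\varphi(0)\|$. $X_0=\{\varphi\in C([-h,0];L^2(\Omega)):\varphi(0)\in D(A)\}$ is the Banach space with norm $\|\varphi\|_{X_0}=\max_{\theta\in[-h,0]}\|\varphi(\theta)\|+\|A\varphi(0)\|$. $L_c(V;W)$ denotes the space of bounded linear operators from $V$ to $W$. The equation defining $X_F$ is an equation in $L^2(\Omega)$.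 *)

theory Defs
  imports "HOL-Analysis.Analysis" "HOL-Library.Function_Algebras"
begin

section \<open>The Hilbert space of square integrable functions\<close>

definition square_integrable :: "('a::euclidean_space \<Rightarrow> real) \<Rightarrow> bool" where
  "square_integrable f \<longleftrightarrow>
     f \<in> borel_measurable lebesgue \<and> integrable lebesgue (\<lambda>x. (f x)\<^sup>2)"

definition L2_rel :: "('a::euclidean_space \<Rightarrow> real) \<Rightarrow> ('a \<Rightarrow> real) \<Rightarrow> bool" where
  "L2_rel f g \<longleftrightarrow> square_integrable f \<and> square_integrable g \<and> (AE x in lebesgue. f x = g x)"

lemma square_integrable_zero: "square_integrable (\<lambda>x. 0)"
  by (simp add: square_integrable_def)

lemma square_integrable_scale: "square_integrable f \<Longrightarrow> square_integrable (\<lambda>x. c * f x)"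
  by (auto simp: square_integrable_def power_mult_distrib)

lemma square_integrable_mult:
  assumes "square_integrable f" "square_integrable g"
  shows "integrable lebesgue (\<lambda>x. f x * g x)"
proof (rule Bochner_Integration.integrable_bound)
  show "integrable lebesgue (\<lambda>x. (f x)\<^sup>2 + (g x)\<^sup>2)"
    using assms by (auto simp: square_integrable_def)
  have "f \<in> borel_measurable lebesgue" "g \<in> borel_measurable lebesgue"
    using assms by (auto simp: square_integrable_def)
  then show "(\<lambda>x. f x * g x) \<in> borel_measurable lebesgue"
    by (rule borel_measurable_times)
  have "\<bar>f x * g x\<bar> \<le> (f x)\<^sup>2 + (g x)\<^sup>2" for x
  proof -
    have "0 \<le> (\<bar>f x\<bar> - \<bar>g x\<bar>)\<^sup>2 + (f x)\<^sup>2 + (g x)\<^sup>2" by simp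
    then show ?thesis by (simp add: power2_diff abs_mult)
  qed
  then show "AE x in lebesgue. norm (f x * g x) \<le> norm ((f x)\<^sup>2 + (g x)\<^sup>2)"
    by (intro AE_I2) (simp add: order.trans[OF _ abs_ge_self])
qed

lemma square_integrable_add:
  assumes "square_integrable f" "square_integrable g"
  shows "square_integrable (\<lambda>x. f x + g x)"
  using assms square_integrable_mult[OF assms]
  by (auto simp: square_integrable_def power2_sum mult.assoc)

lemma square_integrable_diff:
  assumes "square_integrable f" "square_integrable g"
  shows "square_integrable (\<lambda>x. f x - g x)"
  using square_integrable_add[OF assms(1) square_integrable_scale[OF assms(2), of "-1"]] by simp

quotient_type (overloaded) 'a L2 = "'a::euclidean_space \<Rightarrow> real" / partial: L2_rel
proof (rule part_equivpI)
  show "\<exists>f. L2_rel f f"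
    using square_integrable_zero by (auto simp: L2_rel_def)
  show "symp L2_rel"
    by (auto simp: symp_def L2_rel_def)
  show "transp L2_rel"
    unfolding transp_def L2_rel_def by (auto elim: AE_mp)
qed

instantiation L2 :: (euclidean_space) real_vector
begin

lift_definition zero_L2 :: "'a L2" is "\<lambda>x. 0"
  by (simp add: L2_rel_def square_integrable_zero)

lift_definition plus_L2 :: "'a L2 \<Rightarrow> 'a L2 \<Rightarrow> 'a L2" is "\<lambda>f g x. f x + g x"
  unfolding L2_rel_def by (auto intro: square_integrable_add elim!: AE_mp)

lift_definition minus_L2 :: "'a L2 \<Rightarrow> 'a L2 \<Rightarrow> 'a L2" is "\<lambda>f g x. f x - g x"
  unfolding L2_rel_def by (auto intro: square_integrable_diff elim!: AE_mp)

lift_definition scaleR_L2 :: "real \<Rightarrow> 'a L2 \<Rightarrow> 'a L2" is "\<lambda>c f x. c * f x"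
  unfolding L2_rel_def by (auto intro: square_integrable_scale elim!: AE_mp)

definition uminus_L2 :: "'a L2 \<Rightarrow> 'a L2" where
  "uminus_L2 u = (-1) *\<^sub>R u"

instance
proof
  fix u v w :: "'a L2" and a b :: real
  show "u + v + w = u + (v + w)"
    by transfer (auto simp: L2_rel_def add.assoc intro!: square_integrable_add)
  show "u + v = v + u"
    by transfer (auto simp: L2_rel_def add.commute intro!: square_integrable_add)
  show "0 + u = u"
    by transfer (auto simp: L2_rel_def)
  show "- u + u = 0"
    unfolding uminus_L2_def
    by transfer (auto simp: L2_rel_def square_integrable_zero)
  show "u - v = u + - v"
    unfolding uminus_L2_def
    by transfer (auto simp: L2_rel_def intro: square_integrable_diff)
  show "a *\<^sub>R (u + v) = a *\<^sub>R u + a *\<^sub>R v"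
    by transfer (auto simp: L2_rel_def algebra_simps intro!: square_integrable_scale square_integrable_add)
  show "(a + b) *\<^sub>R u = a *\<^sub>R u + b *\<^sub>R u"
    by transfer (auto simp: L2_rel_def distrib_right intro!: square_integrable_scale square_integrable_add)
  show "a *\<^sub>R b *\<^sub>R u = (a * b) *\<^sub>R u"
    by transfer (auto simp: L2_rel_def mult.assoc intro!: square_integrable_scale)
  show "1 *\<^sub>R u = u"
    by transfer (auto simp: L2_rel_def)
qed

end

instantiation L2 :: (euclidean_space) real_inner
begin

lift_definition inner_L2 :: "'a L2 \<Rightarrow> 'a L2 \<Rightarrow> real" is "\<lambda>f g. \<integral>x. f x * g x \<partial>lebesgue"
  unfolding L2_rel_def square_integrable_def
  by (intro integral_cong_AE) (auto elim!: AE_mp)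

definition norm_L2 :: "'a L2 \<Rightarrow> real" where
  "norm_L2 u = sqrt (inner u u)"

definition dist_L2 :: "'a L2 \<Rightarrow> 'a L2 \<Rightarrow> real" where
  "dist_L2 u v = norm (u - v)"

definition sgn_L2 :: "'a L2 \<Rightarrow> 'a L2" where
  "sgn_L2 u = inverse (norm u) *\<^sub>R u"

definition uniformity_L2 :: "('a L2 \<times> 'a L2) filter" where
  "uniformity_L2 = (INF e\<in>{0 <..}. principal {(x, y). dist x y < e})"

definition open_L2 :: "'a L2 set \<Rightarrow> bool" where
  "open_L2 U \<longleftrightarrow> (\<forall>x\<in>U. \<forall>\<^sub>F (x', y) in uniformity. x' = x \<longrightarrow> y \<in> U)"

instance
proof
  fix u v w :: "'a L2" and a :: real
  show "dist u v = norm (u - v)"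
    by (rule dist_L2_def)
  show "sgn u = u /\<^sub>R norm u"
    by (rule sgn_L2_def)
  show "uniformity = (INF e\<in>{0 <..}. principal {(x, y::'a L2). dist x y < e})"
    by (rule uniformity_L2_def)
  fix U :: "'a L2 set"
  show "open U \<longleftrightarrow> (\<forall>x\<in>U. \<forall>\<^sub>F (x', y) in uniformity. x' = x \<longrightarrow> y \<in> U)"
    by (rule open_L2_def)
  show "u \<bullet> v = v \<bullet> u"
    by transfer (simp add: mult.commute)
  show "(u + v) \<bullet> w = u \<bullet> w + v \<bullet> w"
    by transfer (auto simp: L2_rel_def distrib_right
        intro!: Bochner_Integration.integral_add square_integrable_mult)
  show "(a *\<^sub>R u) \<bullet> v = a * (u \<bullet> v)"
    by transfer (simp add: mult.assoc)
  show "0 \<le> u \<bullet> u"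
    by transfer simp
  show "(u \<bullet> u = 0) = (u = 0)"
  proof transfer
    fix f :: "'a \<Rightarrow> real"
    assume "L2_rel f f"
    then have f: "square_integrable f" by (simp add: L2_rel_def)
    then have "(\<integral>x. f x * f x \<partial>lebesgue) = 0 \<longleftrightarrow> (AE x in lebesgue. f x * f x = 0)"
      by (intro integral_nonneg_eq_0_iff_AE square_integrable_mult) auto
    then show "((\<integral>x. f x * f x \<partial>lebesgue) = 0) = L2_rel f (\<lambda>x. 0)"
      using f by (simp add: L2_rel_def square_integrable_zero)
  qed
  show "norm u = sqrt (u \<bullet> u)"
    by (rule norm_L2_def)
qed

end

lemma square_integrable_rep: "square_integrable (rep_L2 u)"
  using Quotient3_rep_reflp[OF Quotient3_L2, of u] by (simp add: L2_rel_def)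

lemma norm_abs_L2:
  assumes "square_integrable f"
  shows "(norm (abs_L2 f))\<^sup>2 = (\<integral>x. (f x)\<^sup>2 \<partial>lebesgue)"
proof -
  have "L2_rel f f" using assms by (simp add: L2_rel_def)
  then have "abs_L2 f \<bullet> abs_L2 f = (\<integral>x. f x * f x \<partial>lebesgue)"
    by (rule inner_L2.abs_eq[OF _ \<open>L2_rel f f\<close>])
  then show ?thesis by (simp add: dot_square_norm power2_eq_square)
qed

lemma abs_rep_diff: "u - v = abs_L2 (\<lambda>x. rep_L2 u x - rep_L2 v x)"
proof -
  have "L2_rel (rep_L2 u) (rep_L2 u)" "L2_rel (rep_L2 v) (rep_L2 v)"
    by (simp_all add: L2_rel_def square_integrable_rep)
  from minus_L2.abs_eq[OF this] show ?thesis
    by (simp add: Quotient3_abs_rep[OF Quotient3_L2])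
qed

lemma integral_abs_mult_le:
  assumes f: "square_integrable f" and g: "square_integrable g"
  shows "(\<integral>x. \<bar>f x\<bar> * g x \<partial>lebesgue) \<le> norm (abs_L2 f) * norm (abs_L2 g)"
proof -
  have f': "square_integrable (\<lambda>x. \<bar>f x\<bar>)"
    using f by (auto simp: square_integrable_def)
  have "L2_rel (\<lambda>x. \<bar>f x\<bar>) (\<lambda>x. \<bar>f x\<bar>)" "L2_rel g g"
    using f' g by (simp_all add: L2_rel_def)
  from inner_L2.abs_eq[OF this]
  have "(\<integral>x. \<bar>f x\<bar> * g x \<partial>lebesgue) = abs_L2 (\<lambda>x. \<bar>f x\<bar>) \<bullet> abs_L2 g" by simp
  also have "\<dots> \<le> norm (abs_L2 (\<lambda>x. \<bar>f x\<bar>)) * norm (abs_L2 g)"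
    by (rule norm_cauchy_schwarz)
  also have "norm (abs_L2 (\<lambda>x. \<bar>f x\<bar>)) = norm (abs_L2 f)"
    by (rule power2_eq_imp_eq) (simp_all add: norm_abs_L2 f f')
  finally show ?thesis .
qed

instance L2 :: (euclidean_space) banach
proof
  fix X :: "nat \<Rightarrow> 'a L2"
  assume X: "Cauchy X"
  define f where "f n = rep_L2 (X n)" for n
  have f: "square_integrable (f n)" for n
    unfolding f_def by (rule square_integrable_rep)
  then have [measurable]: "f n \<in> borel_measurable lebesgue" for n
    by (simp add: square_integrable_def)
  have diff: "X i - X j = abs_L2 (\<lambda>x. f i x - f j x)" for i j
    unfolding f_def by (rule abs_rep_diff)
  obtain w :: "'a \<Rightarrow> real" where w: "w \<in> borel_measurable lborel" "\<And>x. w x > 0" "integrable lborel w"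
    by (rule sigma_finite_measure.obtain_positive_integrable_function[OF sigma_finite_lborel])
      (rule that, assumption+)
  define g where "g x = sqrt (w x)" for x
  have g0: "g x > 0" for x using w(2) by (simp add: g_def)
  have "w \<in> borel_measurable lebesgue" "integrable lebesgue w"
    using w by (auto intro: measurable_completion simp: integrable_completion)
  then have g: "square_integrable g"
    using w(2) by (simp add: square_integrable_def g_def[abs_def] less_imp_le)
  define s where "s n x = f n x * g x" for n x
  have s_int: "integrable lebesgue (s n)" for n
    unfolding s_def by (rule square_integrable_mult[OF f g])
  have s_cauchy: "\<exists>N. \<forall>i\<ge>N. \<forall>j\<ge>N. (\<integral>x. norm (s i x - s j x) \<partial>lebesgue) < e" if "e > 0" for e
  proof -
    define K where "K = norm (abs_L2 g) + 1"
    have "K > 0" by (simp add: K_def add_nonneg_pos)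
    then obtain N where N: "\<And>i j. i \<ge> N \<Longrightarrow> j \<ge> N \<Longrightarrow> norm (X i - X j) < e / K"
      using CauchyD[OF X, of "e / K"] \<open>e > 0\<close> by (meson divide_pos_pos)
    have "(\<integral>x. norm (s i x - s j x) \<partial>lebesgue) < e" if "i \<ge> N" "j \<ge> N" for i j
    proof -
      have "norm (s i x - s j x) = \<bar>f i x - f j x\<bar> * g x" for x
        using g0[of x] by (simp add: s_def left_diff_distrib[symmetric] abs_mult)
      then have "(\<integral>x. norm (s i x - s j x) \<partial>lebesgue) = (\<integral>x. \<bar>f i x - f j x\<bar> * g x \<partial>lebesgue)"
        by simp
      also have "\<dots> \<le> norm (X i - X j) * norm (abs_L2 g)"
        unfolding diff by (rule integral_abs_mult_le[OF square_integrable_diff[OF f f] g])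
      also have "\<dots> \<le> norm (X i - X j) * K"
        by (intro mult_left_mono) (auto simp: K_def)
      also have "\<dots> < e"
        using N[OF that] \<open>K > 0\<close> by (simp add: pos_less_divide_eq)
      finally show ?thesis .
    qed
    then show ?thesis by blast
  qed
  obtain r where r: "strict_mono r" "AE x in lebesgue. Cauchy (\<lambda>i. s (r i) x)"
    using cauchy_L1_AE_cauchy_subseq[OF s_int s_cauchy] by blast
  define F where "F x = lim (\<lambda>i. f (r i) x)" for x
  have [measurable]: "F \<in> borel_measurable lebesgue"
    unfolding F_def by measurable
  have lim: "AE x in lebesgue. (\<lambda>i. f (r i) x) \<longlonglongrightarrow> F x"
    using r(2)
  proof eventually_elim
    case (elim x)
    then have "convergent (\<lambda>i. s (r i) x)" by (simp add: Cauchy_convergent_iff)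
    then have "convergent (\<lambda>i. s (r i) x * inverse (g x))"
      by (intro convergent_mult convergent_const)
    then have "convergent (\<lambda>i. f (r i) x)"
      using g0[of x] by (simp add: s_def mult.assoc less_imp_neq[symmetric])
    then show ?case unfolding F_def by (simp add: convergent_LIMSEQ_iff)
  qed
  have key: "square_integrable (\<lambda>x. f n x - F x) \<and> (norm (abs_L2 (\<lambda>x. f n x - F x)))\<^sup>2 \<le> e\<^sup>2"
    if e: "e > 0" and N: "\<And>j. j \<ge> N \<Longrightarrow> norm (X n - X j) < e" for n N e
  proof -
    have "(\<integral>\<^sup>+x. ennreal ((f n x - F x)\<^sup>2) \<partial>lebesgue)
        = (\<integral>\<^sup>+x. liminf (\<lambda>i. ennreal ((f n x - f (r i) x)\<^sup>2)) \<partial>lebesgue)"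
    proof (rule nn_integral_cong_AE)
      show "AE x in lebesgue. ennreal ((f n x - F x)\<^sup>2) = liminf (\<lambda>i. ennreal ((f n x - f (r i) x)\<^sup>2))"
        using lim
      proof eventually_elim
        case (elim x)
        then have "(\<lambda>i. ennreal ((f n x - f (r i) x)\<^sup>2)) \<longlonglongrightarrow> ennreal ((f n x - F x)\<^sup>2)"
          by (intro tendsto_ennrealI tendsto_intros)
        then show ?case by (intro lim_imp_Liminf[symmetric]) simp_all
      qed
    qed
    also have "\<dots> \<le> liminf (\<lambda>i. \<integral>\<^sup>+x. ennreal ((f n x - f (r i) x)\<^sup>2) \<partial>lebesgue)"
      by (rule nn_integral_liminf) measurable
    also have "\<dots> \<le> limsup (\<lambda>i. \<integral>\<^sup>+x. ennreal ((f n x - f (r i) x)\<^sup>2) \<partial>lebesgue)"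
      by (rule Liminf_le_Limsup) simp
    also have "\<dots> \<le> ennreal (e\<^sup>2)"
    proof (rule Limsup_bounded)
      show "\<forall>\<^sub>F i in sequentially. (\<integral>\<^sup>+x. ennreal ((f n x - f (r i) x)\<^sup>2) \<partial>lebesgue) \<le> ennreal (e\<^sup>2)"
        using eventually_ge_at_top[of N]
      proof eventually_elim
        case (elim i)
        then have "r i \<ge> N" using seq_suble[OF r(1), of i] by linarith
        have sq: "square_integrable (\<lambda>x. f n x - f (r i) x)"
          by (rule square_integrable_diff[OF f f])
        then have "(\<integral>\<^sup>+x. ennreal ((f n x - f (r i) x)\<^sup>2) \<partial>lebesgue)
            = ennreal (\<integral>x. (f n x - f (r i) x)\<^sup>2 \<partial>lebesgue)"
          by (intro nn_integral_eq_integral) (auto simp: square_integrable_def)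
        also have "\<dots> = ennreal ((norm (X n - X (r i)))\<^sup>2)"
          using norm_abs_L2[OF sq] by (simp add: diff)
        also have "\<dots> \<le> ennreal (e\<^sup>2)"
          using N[OF \<open>r i \<ge> N\<close>] by (intro ennreal_leI power_mono) auto
        finally show ?case .
      qed
    qed
    finally have le: "(\<integral>\<^sup>+x. ennreal ((f n x - F x)\<^sup>2) \<partial>lebesgue) \<le> ennreal (e\<^sup>2)" .
    have int: "integrable lebesgue (\<lambda>x. (f n x - F x)\<^sup>2)"
      using le by (intro integrableI_bounded) (auto intro: le_less_trans)
    then have sq: "square_integrable (\<lambda>x. f n x - F x)"
      by (simp add: square_integrable_def)
    have "ennreal (\<integral>x. (f n x - F x)\<^sup>2 \<partial>lebesgue) \<le> ennreal (e\<^sup>2)"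
      using le nn_integral_eq_integral[OF int] by simp
    then show ?thesis using sq norm_abs_L2[OF sq] by simp
  qed
  have sqF: "square_integrable F"
  proof -
    obtain N where N: "\<And>i j. i \<ge> N \<Longrightarrow> j \<ge> N \<Longrightarrow> norm (X i - X j) < 1"
      using CauchyD[OF X, of 1] by auto
    have "square_integrable (\<lambda>x. f N x - F x)"
      using key[of 1 N N] N by auto
    from square_integrable_diff[OF f[of N] this] show ?thesis by simp
  qed
  have lim_diff: "X n - abs_L2 F = abs_L2 (\<lambda>x. f n x - F x)" for n
  proof -
    have "L2_rel (f n) (f n)" "L2_rel F F"
      by (simp_all add: L2_rel_def f sqF)
    from minus_L2.abs_eq[OF this] show ?thesis
      by (simp add: f_def Quotient3_abs_rep[OF Quotient3_L2])
  qed
  have "X \<longlonglongrightarrow> abs_L2 F"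
  proof (rule LIMSEQ_I)
    fix e :: real assume "e > 0"
    then obtain N where N: "\<And>i j. i \<ge> N \<Longrightarrow> j \<ge> N \<Longrightarrow> norm (X i - X j) < e / 2"
      using CauchyD[OF X, of "e / 2"] by auto
    have "norm (X n - abs_L2 F) < e" if "n \<ge> N" for n
    proof -
      have "(norm (X n - abs_L2 F))\<^sup>2 \<le> (e / 2)\<^sup>2"
        using key[of "e / 2" N n] N[OF that] \<open>e > 0\<close> by (simp add: lim_diff)
      then have "norm (X n - abs_L2 F) \<le> e / 2"
        using \<open>e > 0\<close> by (simp add: power2_le_iff_abs_le)
      then show ?thesis using \<open>e > 0\<close> by simp
    qed
    then show "\<exists>no. \<forall>n\<ge>no. norm (X n - abs_L2 F) < e" by blast
  qed
  then show "convergent X" by (rule convergentI)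
qed

text \<open>
  A type cannot depend on the term \<open>\<Omega>\<close>, so \<open>L\<^sup>2(\<Omega>)\<close> is rendered as the closed
  subspace of \<open>L\<^sup>2(\<real>\<^sup>n)\<close> consisting of the classes that vanish almost everywhere outside
  \<open>\<Omega>\<close>; extension by zero identifies the two isometrically.
\<close>

lift_definition vanishes_outside :: "'a::euclidean_space set \<Rightarrow> 'a L2 \<Rightarrow> bool" is
  "\<lambda>\<Omega> f. AE x in lebesgue. x \<notin> \<Omega> \<longrightarrow> f x = 0"
proof -
  fix \<Omega> :: "'a set" and f g :: "'a \<Rightarrow> real"
  assume "L2_rel f g"
  then have "AE x in lebesgue. f x = g x" by (simp add: L2_rel_def)
  then have "AE x in lebesgue. (x \<notin> \<Omega> \<longrightarrow> f x = 0) \<longleftrightarrow> (x \<notin> \<Omega> \<longrightarrow> g x = 0)"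
    by eventually_elim simp
  then show "(AE x in lebesgue. x \<notin> \<Omega> \<longrightarrow> f x = 0) = (AE x in lebesgue. x \<notin> \<Omega> \<longrightarrow> g x = 0)"
    by (rule eventually_subst)
qed

definition L2_on :: "'a::euclidean_space set \<Rightarrow> 'a L2 set" where
  "L2_on \<Omega> = {u. vanishes_outside \<Omega> u}"


section \<open>Differential calculus in normed spaces given by a carrier and a norm\<close>

text \<open>
  The spaces of paths below depend on \<open>h\<close>, \<open>\<Omega>\<close> and \<open>A\<close>, and \<open>X\<close>, \<open>X\<^sub>0\<close> and
  \<open>C([-h,0];L\<^sup>2(\<Omega>))\<close> share vectors but not norms. A normed space is therefore a linear subspace
  of an ambient vector space together with a norm on it; values of maps and of norms off the
  carrier are irrelevant.
\<close>

instantiation "fun" :: (type, real_vector) real_vector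
begin

definition scaleR_fun :: "real \<Rightarrow> ('a \<Rightarrow> 'b) \<Rightarrow> 'a \<Rightarrow> 'b" where
  "scaleR_fun c f = (\<lambda>x. c *\<^sub>R f x)"

instance
  by standard (simp_all add: scaleR_fun_def fun_eq_iff scaleR_add_right scaleR_add_left)

end

record 'v nspace =
  carr :: "'v set"
  nrm :: "'v \<Rightarrow> real"

definition sub_nspace :: "'v::real_normed_vector set \<Rightarrow> 'v nspace" where
  "sub_nspace H = \<lparr>carr = H, nrm = norm\<rparr>"

definition nopen :: "'v::real_vector nspace \<Rightarrow> 'v set \<Rightarrow> bool" where
  "nopen V U \<longleftrightarrow> U \<subseteq> carr V \<and>
     (\<forall>x\<in>U. \<exists>e>0. \<forall>y\<in>carr V. nrm V (y - x) < e \<longrightarrow> y \<in> U)"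

definition nclosed :: "'v::real_vector nspace \<Rightarrow> 'v set \<Rightarrow> bool" where
  "nclosed V Y \<longleftrightarrow> Y \<subseteq> carr V \<and> nopen V (carr V - Y)"

definition Lc :: "'v::real_vector nspace \<Rightarrow> 'w::real_vector nspace \<Rightarrow> ('v \<Rightarrow> 'w) set" where
  "Lc V W = {L. (\<forall>x\<in>carr V. L x \<in> carr W) \<and>
     (\<forall>x\<in>carr V. \<forall>y\<in>carr V. L (x + y) = L x + L y) \<and>
     (\<forall>c. \<forall>x\<in>carr V. L (c *\<^sub>R x) = c *\<^sub>R L x) \<and>
     (\<exists>K. \<forall>x\<in>carr V. nrm W (L x) \<le> K * nrm V x)}"

definition opnorm :: "'v::real_vector nspace \<Rightarrow> 'w::real_vector nspace \<Rightarrow> ('v \<Rightarrow> 'w) \<Rightarrow> real" where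
  "opnorm V W L = (SUP x\<in>carr V. nrm W (L x) / nrm V x)"

definition frechet_derivative_at ::
  "'v::real_vector nspace \<Rightarrow> 'w::real_vector nspace \<Rightarrow> 'v set \<Rightarrow> ('v \<Rightarrow> 'w) \<Rightarrow> 'v \<Rightarrow> ('v \<Rightarrow> 'w) \<Rightarrow> bool"
where
  "frechet_derivative_at V W U f x L \<longleftrightarrow> L \<in> Lc V W \<and>
     (\<forall>e>0. \<exists>d>0. \<forall>y\<in>U. nrm V (y - x) < d \<longrightarrow>
        nrm W (f y - f x - L (y - x)) \<le> e * nrm V (y - x))"

definition C1_map ::
  "'v::real_vector nspace \<Rightarrow> 'w::real_vector nspace \<Rightarrow> 'v set \<Rightarrow> ('v \<Rightarrow> 'w) \<Rightarrow> ('v \<Rightarrow> 'v \<Rightarrow> 'w) \<Rightarrow> bool"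
where
  "C1_map V W U f Df \<longleftrightarrow> (\<forall>x\<in>U. f x \<in> carr W) \<and>
     (\<forall>x\<in>U. frechet_derivative_at V W U f x (Df x)) \<and>
     (\<forall>x\<in>U. \<forall>e>0. \<exists>d>0. \<forall>y\<in>U. nrm V (y - x) < d \<longrightarrow> opnorm V W (Df y - Df x) < e)"

definition C1_diffeo ::
  "'v::real_vector nspace \<Rightarrow> 'w::real_vector nspace \<Rightarrow> 'v set \<Rightarrow> 'w set \<Rightarrow> ('v \<Rightarrow> 'w) \<Rightarrow> bool"
where
  "C1_diffeo V W S T \<Phi> \<longleftrightarrow> nopen V S \<and> nopen W T \<and> bij_betw \<Phi> S T \<and>
     (\<exists>D\<Phi>. C1_map V W S \<Phi> D\<Phi>) \<and> (\<exists>D\<Psi>. C1_map W V T (inv_into S \<Phi>) D\<Psi>)"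

definition closed_splitting :: "'v::real_vector nspace \<Rightarrow> 'v set \<Rightarrow> 'v set \<Rightarrow> bool" where
  "closed_splitting V Y Z \<longleftrightarrow> subspace Y \<and> subspace Z \<and> nclosed V Y \<and> nclosed V Z \<and>
     Y \<inter> Z = {0} \<and> carr V = {y + z | y z. y \<in> Y \<and> z \<in> Z}"

text \<open>
  Submanifolds of a Banach space: near each of its points, \<open>M\<close> is straightened by a \<open>C\<^sup>1\<close>
  diffeomorphism onto a relatively open part of a closed subspace that has a closed complement.
\<close>

definition C1_submanifold :: "'v::real_vector nspace \<Rightarrow> 'v set \<Rightarrow> bool" where
  "C1_submanifold V M \<longleftrightarrow> M \<subseteq> carr V \<and>
     (\<forall>x\<in>M. \<exists>Y Z S T \<Phi>. closed_splitting V Y Z \<and> x \<in> S \<and> C1_diffeo V V S T \<Phi> \<and>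
        \<Phi> ` (M \<inter> S) = Y \<inter> T)"


section \<open>Compact analytic semigroups\<close>

definition C0_semigroup :: "'v::real_normed_vector set \<Rightarrow> (real \<Rightarrow> 'v \<Rightarrow> 'v) \<Rightarrow> bool" where
  "C0_semigroup H T \<longleftrightarrow>
     (\<forall>t\<ge>0. T t \<in> Lc (sub_nspace H) (sub_nspace H)) \<and>
     (\<forall>x\<in>H. T 0 x = x) \<and>
     (\<forall>s\<ge>0. \<forall>t\<ge>0. \<forall>x\<in>H. T (s + t) x = T s (T t x)) \<and>
     (\<forall>x\<in>H. ((\<lambda>t. T t x) \<longlongrightarrow> x) (at_right 0))"

text \<open>The infinitesimal generator, an unbounded operator \<open>G\<close> with domain \<open>D\<close>.\<close>

definition generator ::
  "'v::real_normed_vector set \<Rightarrow> (real \<Rightarrow> 'v \<Rightarrow> 'v) \<Rightarrow> 'v set \<Rightarrow> ('v \<Rightarrow> 'v) \<Rightarrow> bool"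
where
  "generator H T D G \<longleftrightarrow>
     D = {x\<in>H. \<exists>y\<in>H. ((\<lambda>t. (1 / t) *\<^sub>R (T t x - x)) \<longlongrightarrow> y) (at_right 0)} \<and>
     (\<forall>x\<in>D. ((\<lambda>t. (1 / t) *\<^sub>R (T t x - x)) \<longlongrightarrow> G x) (at_right 0))"

definition compact_semigroup :: "'v::real_normed_vector set \<Rightarrow> (real \<Rightarrow> 'v \<Rightarrow> 'v) \<Rightarrow> bool" where
  "compact_semigroup H T \<longleftrightarrow>
     (\<forall>t>0. \<forall>S. S \<subseteq> H \<and> bounded S \<longrightarrow> compact (closure (T t ` S)))"

text \<open>
  Analyticity of a semigroup on a real space refers to its complexification \<open>H \<times> H\<close>, where
  \<open>(x, y)\<close> stands for \<open>x + i y\<close>: the complexified semigroup must extend analytically to a sector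
  around the positive half-axis. In the last clause of \<open>analytic_semigroup\<close>, the complex
  derivative is the real derivative of the special form \<open>\<zeta> \<mapsto> \<zeta> d\<close>.
\<close>

definition cscale :: "complex \<Rightarrow> 'v::real_vector \<times> 'v \<Rightarrow> 'v \<times> 'v" where
  "cscale z v = (Re z *\<^sub>R fst v - Im z *\<^sub>R snd v, Im z *\<^sub>R fst v + Re z *\<^sub>R snd v)"

definition sector :: "real \<Rightarrow> complex set" where
  "sector \<delta> = {z. z \<noteq> 0 \<and> \<bar>Arg z\<bar> < \<delta>}"

definition analytic_semigroup :: "'v::real_normed_vector set \<Rightarrow> (real \<Rightarrow> 'v \<Rightarrow> 'v) \<Rightarrow> bool" where
  "analytic_semigroup H T \<longleftrightarrow> (\<exists>\<delta> S. 0 < \<delta> \<and> \<delta> \<le> pi / 2 \<and>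
     (\<forall>z\<in>sector \<delta>. S z \<in> Lc (sub_nspace (H \<times> H)) (sub_nspace (H \<times> H))) \<and>
     (\<forall>z\<in>sector \<delta>. \<forall>c. \<forall>v\<in>H \<times> H. S z (cscale c v) = cscale c (S z v)) \<and>
     (\<forall>t>0. \<forall>x\<in>H. \<forall>y\<in>H. S (of_real t) (x, y) = (T t x, T t y)) \<and>
     (\<forall>z\<in>sector \<delta>. \<forall>w\<in>sector \<delta>. \<forall>v\<in>H \<times> H. S (z + w) v = S z (S w v)) \<and>
     (\<forall>v\<in>H \<times> H. ((\<lambda>z. S z v) \<longlongrightarrow> v) (at 0 within sector \<delta>)) \<and>
     (\<forall>v\<in>H \<times> H. \<forall>z\<in>sector \<delta>. \<exists>d\<in>H \<times> H.
        ((\<lambda>w. S w v) has_derivative (\<lambda>\<zeta>. cscale \<zeta> d)) (at z)))"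

definition generates_compact_analytic_semigroup ::
  "'v::real_normed_vector set \<Rightarrow> 'v set \<Rightarrow> ('v \<Rightarrow> 'v) \<Rightarrow> bool"
where
  "generates_compact_analytic_semigroup H D G \<longleftrightarrow>
     (\<exists>T. C0_semigroup H T \<and> generator H T D G \<and> compact_semigroup H T \<and> analytic_semigroup H T)"


section \<open>Spaces of paths and the delay equation\<close>

text \<open>
  A path on \<open>[-h, 0]\<close> is represented by the function on \<open>\<real>\<close> that is zero elsewhere, which makes
  the representation unique and linear. The suprema below are attained for \<open>h > 0\<close>, so they are
  the maxima of the usual norms.
\<close>

definition sup_norm :: "real \<Rightarrow> (real \<Rightarrow> 'v::real_normed_vector) \<Rightarrow> real" where
  "sup_norm h \<phi> = (SUP \<theta>\<in>{-h..0}. norm (\<phi> \<theta>))"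

definition path_deriv :: "real \<Rightarrow> (real \<Rightarrow> 'v::real_normed_vector) \<Rightarrow> real \<Rightarrow> 'v" where
  "path_deriv h \<phi> \<theta> = vector_derivative \<phi> (at \<theta> within {-h..0})"

definition C_space :: "real \<Rightarrow> 'v::real_normed_vector set \<Rightarrow> (real \<Rightarrow> 'v) nspace" where
  "C_space h H = \<lparr>
     carr = {\<phi>. continuous_on {-h..0} \<phi> \<and> (\<forall>\<theta>\<in>{-h..0}. \<phi> \<theta> \<in> H) \<and> (\<forall>\<theta>. \<theta> \<notin> {-h..0} \<longrightarrow> \<phi> \<theta> = 0)},
     nrm = sup_norm h\<rparr>"

definition X_space ::
  "real \<Rightarrow> 'v::real_normed_vector set \<Rightarrow> 'v set \<Rightarrow> ('v \<Rightarrow> 'v) \<Rightarrow> (real \<Rightarrow> 'v) nspace"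
where
  "X_space h H D A = \<lparr>
     carr = {\<phi> \<in> carr (C_space h H).
       (\<forall>\<theta>\<in>{-h..0}. \<phi> differentiable (at \<theta> within {-h..0})) \<and>
       continuous_on {-h..0} (path_deriv h \<phi>) \<and> \<phi> 0 \<in> D},
     nrm = (\<lambda>\<phi>. sup_norm h \<phi> + sup_norm h (path_deriv h \<phi>) + norm (A (\<phi> 0)))\<rparr>"

definition X0_space ::
  "real \<Rightarrow> 'v::real_normed_vector set \<Rightarrow> 'v set \<Rightarrow> ('v \<Rightarrow> 'v) \<Rightarrow> (real \<Rightarrow> 'v) nspace"
where
  "X0_space h H D A = \<lparr>
     carr = {\<phi> \<in> carr (C_space h H). \<phi> 0 \<in> D},
     nrm = (\<lambda>\<phi>. sup_norm h \<phi> + norm (A (\<phi> 0)))\<rparr>"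

definition delay_term :: "('v \<Rightarrow> 'v) \<Rightarrow> ((real \<Rightarrow> 'v) \<Rightarrow> real) \<Rightarrow> (real \<Rightarrow> 'v) \<Rightarrow> 'v" where
  "delay_term B r \<phi> = B (\<phi> (- r \<phi>))"

definition solution_manifold ::
  "real \<Rightarrow> ('v::real_normed_vector \<Rightarrow> 'v) \<Rightarrow> ((real \<Rightarrow> 'v) \<Rightarrow> 'v) \<Rightarrow> (real \<Rightarrow> 'v) set \<Rightarrow> (real \<Rightarrow> 'v) set"
where
  "solution_manifold h A F U = {\<phi> \<in> U. path_deriv h \<phi> 0 + A (\<phi> 0) = F \<phi>}"


end

theory Submission
  imports Defs
begin

text \<open>
  The set \<open>X\<^sub>F\<close> is the level set \<open>\<Lambda> \<phi> = F \<phi>\<close> in \<open>X\<close>, where \<open>\<Lambda> \<phi> = \<phi>'(0) + A \<phi>(0)\<close> is linear and bounded.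
  Two features make it a submanifold.

  First, \<open>\<Lambda>\<close> has right inverses that are small for the norm of \<open>X\<^sub>0\<close>. The norm of \<open>X\<^sub>0\<close> does not see
  derivatives, so the short waves \<open>J q = (\<theta> \<mapsto> \<epsilon> sin (\<theta> / \<epsilon>) q)\<close> have \<open>(J q)(0) = 0\<close> and \<open>(J q)'(0) = q\<close>,
  hence \<open>\<Lambda> (J q) = q\<close>, while their \<open>X\<^sub>0\<close>-norm is at most \<open>\<epsilon> \<parallel>q\<parallel>\<close>. As \<open>DF(\<phi>)\<close> extends to a bounded
  operator on \<open>X\<^sub>0\<close>, a small \<open>\<epsilon>\<close> gives \<open>\<parallel>DF(\<phi>) (J q)\<parallel> \<le> \<parallel>q\<parallel> / 2\<close>.

  Second, such a \<open>J\<close> straightens the level set near a point \<open>x\<^sub>0\<close> of it. Put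
  \<open>\<Phi> x = x - x\<^sub>0 - J (F x - F x\<^sub>0)\<close>. Applying \<open>\<Lambda>\<close> gives \<open>\<Lambda> (\<Phi> x) = \<Lambda> x - F x\<close>, so \<open>\<Phi>\<close> maps the level set
  into the kernel of \<open>\<Lambda>\<close>, and \<open>ker \<Lambda> \<oplus> range J\<close> is a closed splitting because \<open>J \<circ> \<Lambda>\<close> is a bounded
  projection (lemma \<open>level_set_C1_submanifold\<close>). That \<open>\<Phi>\<close> is a local diffeomorphism is an inverse
  function theorem for a perturbation of the identity that factors through \<open>H = L\<^sup>2(\<Omega>)\<close>: with
  \<open>p = F x - F x\<^sub>0\<close>, the equation \<open>\<Phi> x = w\<close> becomes \<open>p = F (x\<^sub>0 + w + J p) - F x\<^sub>0\<close>, a fixed point problem in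
  \<open>H\<close> whose right-hand side is a contraction near \<open>0\<close> since \<open>\<parallel>DF(x\<^sub>0) J\<parallel> < 1\<close>
  (lemma \<open>perturbed_identity_C1_diffeo\<close>). Banach's fixed point theorem is thus applied in \<open>H\<close>, a closed
  subspace of a Banach space.

  The semigroup enters through its generator: \<open>A\<close> is a linear map into \<open>H\<close> on a linear domain
  (lemma \<open>generator_linear\<close>).
\<close>

section \<open>Carrier normed spaces and bounded linear maps\<close>

locale normed_carrier =
  fixes V :: "'v::real_vector nspace"
  assumes subspace_carr: "subspace (carr V)"
    and nrm_nonneg: "x \<in> carr V \<Longrightarrow> 0 \<le> nrm V x"
    and nrm_eq_0: "x \<in> carr V \<Longrightarrow> nrm V x = 0 \<Longrightarrow> x = 0"
    and nrm_scaleR: "x \<in> carr V \<Longrightarrow> nrm V (c *\<^sub>R x) = \<bar>c\<bar> * nrm V x"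
    and nrm_triangle: "x \<in> carr V \<Longrightarrow> y \<in> carr V \<Longrightarrow> nrm V (x + y) \<le> nrm V x + nrm V y"
begin

lemma zero_carr [simp]: "0 \<in> carr V"
  using subspace_carr by (rule subspace_0)

lemma add_carr [simp]: "x \<in> carr V \<Longrightarrow> y \<in> carr V \<Longrightarrow> x + y \<in> carr V"
  using subspace_carr by (rule subspace_add)

lemma diff_carr [simp]: "x \<in> carr V \<Longrightarrow> y \<in> carr V \<Longrightarrow> x - y \<in> carr V"
  using subspace_carr by (rule subspace_diff)

lemma scaleR_carr [simp]: "x \<in> carr V \<Longrightarrow> c *\<^sub>R x \<in> carr V"
  using subspace_carr by (rule subspace_scale)

lemma nrm_zero [simp]: "nrm V 0 = 0"
  using nrm_scaleR[of 0 0] by simp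

lemma nrm_minus_commute: "x \<in> carr V \<Longrightarrow> y \<in> carr V \<Longrightarrow> nrm V (x - y) = nrm V (y - x)"
  using nrm_scaleR[of "y - x" "-1"] by simp

lemma nrm_triangle_diff:
  "x \<in> carr V \<Longrightarrow> y \<in> carr V \<Longrightarrow> nrm V (x - y) \<le> nrm V x + nrm V y"
  using nrm_triangle[of x "- y"] nrm_scaleR[of y "-1"] scaleR_carr[of y "-1"] by simp

end

lemma normed_carrier_sub_nspace: "subspace H \<Longrightarrow> normed_carrier (sub_nspace H)"
  by unfold_locales (auto simp: sub_nspace_def norm_triangle_ineq)

lemma carr_sub_nspace [simp]: "carr (sub_nspace H) = H"
  by (simp add: sub_nspace_def)

lemma nrm_sub_nspace [simp]: "nrm (sub_nspace H) = norm"
  by (simp add: sub_nspace_def)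

lemma LcI:
  assumes "\<And>x. x \<in> carr V \<Longrightarrow> L x \<in> carr W"
    and "\<And>x y. x \<in> carr V \<Longrightarrow> y \<in> carr V \<Longrightarrow> L (x + y) = L x + L y"
    and "\<And>c x. x \<in> carr V \<Longrightarrow> L (c *\<^sub>R x) = c *\<^sub>R L x"
    and "\<And>x. x \<in> carr V \<Longrightarrow> nrm W (L x) \<le> K * nrm V x"
  shows "L \<in> Lc V W"
  unfolding Lc_def using assms by blast

lemma Lc_carr: "L \<in> Lc V W \<Longrightarrow> x \<in> carr V \<Longrightarrow> L x \<in> carr W"
  and Lc_add: "L \<in> Lc V W \<Longrightarrow> x \<in> carr V \<Longrightarrow> y \<in> carr V \<Longrightarrow> L (x + y) = L x + L y"
  and Lc_scaleR: "L \<in> Lc V W \<Longrightarrow> x \<in> carr V \<Longrightarrow> L (c *\<^sub>R x) = c *\<^sub>R L x"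
  by (auto simp: Lc_def)

lemma Lc_bounded:
  assumes "normed_carrier V" "L \<in> Lc V W"
  obtains K where "K > 0" "\<And>x. x \<in> carr V \<Longrightarrow> nrm W (L x) \<le> K * nrm V x"
proof -
  interpret V: normed_carrier V by fact
  from assms(2) obtain K where K: "\<And>x. x \<in> carr V \<Longrightarrow> nrm W (L x) \<le> K * nrm V x"
    unfolding Lc_def by blast
  show ?thesis
  proof (rule that)
    show "\<bar>K\<bar> + 1 > 0" by simp
    show "nrm W (L x) \<le> (\<bar>K\<bar> + 1) * nrm V x" if "x \<in> carr V" for x
      using K[OF that] mult_right_mono[of K "\<bar>K\<bar> + 1" "nrm V x"] V.nrm_nonneg[OF that] by linarith
  qed
qed

lemma Lc_diff:
  assumes "normed_carrier V" "L \<in> Lc V W" "x \<in> carr V" "y \<in> carr V"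
  shows "L (x - y) = L x - L y"
proof -
  interpret V: normed_carrier V by fact
  show ?thesis using Lc_add[OF assms(2), of "x - y" y] assms by simp
qed

lemma Lc_zero: "normed_carrier V \<Longrightarrow> L \<in> Lc V W \<Longrightarrow> L 0 = 0"
  using Lc_diff[of V L W 0 0] by (simp add: normed_carrier.zero_carr)

lemma minus_in_Lc:
  assumes V: "normed_carrier V" and W: "normed_carrier W" and L: "L \<in> Lc V W" "M \<in> Lc V W"
  shows "L - M \<in> Lc V W"
proof -
  interpret V: normed_carrier V by fact
  interpret W: normed_carrier W by fact
  obtain K where K: "\<And>x. x \<in> carr V \<Longrightarrow> nrm W (L x) \<le> K * nrm V x"
    using Lc_bounded[OF V L(1)] by blast
  obtain K' where K': "\<And>x. x \<in> carr V \<Longrightarrow> nrm W (M x) \<le> K' * nrm V x"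
    using Lc_bounded[OF V L(2)] by blast
  show ?thesis
  proof (rule LcI[where K = "K + K'"])
    fix x assume "x \<in> carr V"
    then show "nrm W ((L - M) x) \<le> (K + K') * nrm V x"
      using W.nrm_triangle_diff[of "L x" "M x"] K[of x] K'[of x] Lc_carr[OF L(1)] Lc_carr[OF L(2)]
      by (simp add: distrib_right)
  qed (auto simp: Lc_carr[OF L(1)] Lc_carr[OF L(2)] Lc_add[OF L(1)] Lc_add[OF L(2)]
      Lc_scaleR[OF L(1)] Lc_scaleR[OF L(2)] scaleR_diff_right)
qed

lemma compose_in_Lc:
  assumes V: "normed_carrier V" and W: "normed_carrier W" and L: "L \<in> Lc V W" and M: "M \<in> Lc W Z"
  shows "(\<lambda>x. M (L x)) \<in> Lc V Z"
proof -
  obtain K where K: "\<And>x. x \<in> carr V \<Longrightarrow> nrm W (L x) \<le> K * nrm V x"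
    using Lc_bounded[OF V L] by blast
  obtain K' where K': "K' > 0" "\<And>x. x \<in> carr W \<Longrightarrow> nrm Z (M x) \<le> K' * nrm W x"
    using Lc_bounded[OF W M] by blast
  show ?thesis
  proof (rule LcI[where K = "K' * K"])
    fix x assume x: "x \<in> carr V"
    have "nrm Z (M (L x)) \<le> K' * nrm W (L x)" using K'(2) Lc_carr[OF L x] .
    also have "\<dots> \<le> K' * (K * nrm V x)" using K[OF x] K'(1) by (intro mult_left_mono) auto
    finally show "nrm Z (M (L x)) \<le> K' * K * nrm V x" by (simp add: mult.assoc)
  qed (auto simp: Lc_carr[OF L] Lc_carr[OF M] Lc_add[OF L] Lc_add[OF M] Lc_scaleR[OF L] Lc_scaleR[OF M])
qed

lemma opnorm_bound:
  assumes V: "normed_carrier V" and W: "normed_carrier W" and L: "L \<in> Lc V W" and x: "x \<in> carr V"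
  shows "nrm W (L x) \<le> opnorm V W L * nrm V x"
proof -
  interpret V: normed_carrier V by fact
  interpret W: normed_carrier W by fact
  obtain K where K: "K > 0" "\<And>x. x \<in> carr V \<Longrightarrow> nrm W (L x) \<le> K * nrm V x"
    using Lc_bounded[OF V L] by blast
  show ?thesis
  proof (cases "nrm V x = 0")
    case True
    then show ?thesis using K(2)[OF x] by simp
  next
    case False
    then have pos: "nrm V x > 0" using V.nrm_nonneg[OF x] by simp
    have "nrm W (L y) / nrm V y \<le> K" if "y \<in> carr V" for y
      using K(2)[OF that] K(1) V.nrm_nonneg[OF that]
      by (cases "nrm V y = 0") (auto simp: divide_le_eq)
    then have "nrm W (L x) / nrm V x \<le> opnorm V W L"
      unfolding opnorm_def by (intro cSUP_upper x bdd_aboveI2)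
    then show ?thesis using pos by (simp add: divide_le_eq)
  qed
qed

lemma opnorm_le:
  assumes V: "normed_carrier V" and "K \<ge> 0"
    and K: "\<And>x. x \<in> carr V \<Longrightarrow> nrm W (L x) \<le> K * nrm V x"
  shows "opnorm V W L \<le> K"
proof -
  interpret V: normed_carrier V by fact
  show ?thesis unfolding opnorm_def
  proof (rule cSUP_least)
    show "carr V \<noteq> {}" using V.zero_carr by blast
    show "nrm W (L x) / nrm V x \<le> K" if "x \<in> carr V" for x
      using K[OF that] \<open>K \<ge> 0\<close> V.nrm_nonneg[OF that]
      by (cases "nrm V x = 0") (auto simp: divide_le_eq)
  qed
qed

lemma kernel_subspace:
  assumes V: "normed_carrier V" and L: "L \<in> Lc V W"
  shows "subspace {v \<in> carr V. L v = 0}"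
proof -
  interpret V: normed_carrier V by fact
  show ?thesis using Lc_zero[OF V L] Lc_add[OF L] Lc_scaleR[OF L] by (auto intro!: subspaceI)
qed

lemma kernel_nclosed:
  assumes V: "normed_carrier V" and W: "normed_carrier W" and L: "L \<in> Lc V W"
  shows "nclosed V {v \<in> carr V. L v = 0}"
  unfolding nclosed_def nopen_def
proof (intro conjI ballI)
  interpret V: normed_carrier V by fact
  interpret W: normed_carrier W by fact
  obtain l where l: "l > 0" "\<And>v. v \<in> carr V \<Longrightarrow> nrm W (L v) \<le> l * nrm V v"
    using Lc_bounded[OF V L] by blast
  fix x assume x: "x \<in> carr V - {v \<in> carr V. L v = 0}"
  then have Lx: "L x \<in> carr W" "L x \<noteq> 0" using Lc_carr[OF L] by auto
  then have pos: "nrm W (L x) > 0" using W.nrm_nonneg W.nrm_eq_0 by (metis less_eq_real_def)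
  show "\<exists>e>0. \<forall>y\<in>carr V. nrm V (y - x) < e \<longrightarrow> y \<in> carr V - {v \<in> carr V. L v = 0}"
  proof (intro exI[of _ "nrm W (L x) / l"] conjI ballI impI)
    show "nrm W (L x) / l > 0" using pos l by simp
    fix y assume y: "y \<in> carr V" "nrm V (y - x) < nrm W (L x) / l"
    have "L y \<noteq> 0"
    proof
      assume "L y = 0"
      then have "nrm W (L x) \<le> l * nrm V (x - y)"
        using l(2)[of "x - y"] Lc_diff[OF V L, of x y] x y by simp
      then show False using y l(1) V.nrm_minus_commute[of x y] x by (simp add: field_simps)
    qed
    then show "y \<in> carr V - {v \<in> carr V. L v = 0}" using y by simp
  qed
qed auto

section \<open>Inverses of \<open>C\<^sup>1\<close> maps\<close>

lemma inv_into_in_Lc: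
  assumes V: "normed_carrier V" and L: "L \<in> Lc V V" and bij: "bij_betw L (carr V) (carr V)"
    and bound: "\<And>u. u \<in> carr V \<Longrightarrow> nrm V u \<le> K * nrm V (L u)"
  shows "inv_into (carr V) L \<in> Lc V V"
proof -
  interpret V: normed_carrier V by fact
  let ?M = "inv_into (carr V) L"
  have M: "?M v \<in> carr V" and LM: "L (?M v) = v" if "v \<in> carr V" for v
    using bij that by (auto simp: bij_betw_def inv_into_into f_inv_into_f)
  have Minv: "?M (L u) = u" if "u \<in> carr V" for u
    using bij that by (auto simp: bij_betw_def)
  show ?thesis
  proof (rule LcI[where K = K])
    fix v w :: 'a and c :: real assume v: "v \<in> carr V"
    show "?M v \<in> carr V" using M[OF v] .
    show "nrm V (?M v) \<le> K * nrm V v" using bound[OF M[OF v]] LM[OF v] by simp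
    have "L (c *\<^sub>R ?M v) = c *\<^sub>R v" using Lc_scaleR[OF L M[OF v]] LM[OF v] by simp
    then show "?M (c *\<^sub>R v) = c *\<^sub>R ?M v" using Minv[of "c *\<^sub>R ?M v"] M[OF v] by simp
    assume w: "w \<in> carr V"
    have "L (?M v + ?M w) = v + w" using Lc_add[OF L M[OF v] M[OF w]] LM v w by simp
    then show "?M (v + w) = ?M v + ?M w" using Minv[of "?M v + ?M w"] M v w by simp
  qed
qed

text \<open>
  Once injectivity, openness of the image and invertibility of the derivatives are known, the inverse
  is \<open>C\<^sup>1\<close> by estimates alone. The expansion bounds say that the inverse map is Lipschitz and that the
  inverse derivatives are bounded, both with the constant \<open>K\<close> on the whole domain. With
  \<open>M\<^sub>x = D\<Phi>(x)\<inverse>\<close>, the remainder of the inverse at \<open>\<Phi> x\<close> is \<open>-M\<^sub>x\<close> applied to the remainder of \<open>\<Phi>\<close> at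
  \<open>x\<close>, and \<open>x \<mapsto> M\<^sub>x\<close> is continuous by \<open>M\<^sub>y - M\<^sub>x = M\<^sub>y (D\<Phi>(x) - D\<Phi>(y)) M\<^sub>x\<close>.
\<close>

lemma C1_diffeoI:
  assumes V: "normed_carrier V" and S: "nopen V S" and T: "nopen V T"
    and bij: "bij_betw \<Phi> S T" and C1: "C1_map V V S \<Phi> D\<Phi>" and "K > 0"
    and expand: "\<And>x y. x \<in> S \<Longrightarrow> y \<in> S \<Longrightarrow> nrm V (x - y) \<le> K * nrm V (\<Phi> x - \<Phi> y)"
    and Dbij: "\<And>x. x \<in> S \<Longrightarrow> bij_betw (D\<Phi> x) (carr V) (carr V)"
    and Dexpand: "\<And>x u. x \<in> S \<Longrightarrow> u \<in> carr V \<Longrightarrow> nrm V u \<le> K * nrm V (D\<Phi> x u)"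
  shows "C1_diffeo V V S T \<Phi>"
proof -
  interpret V: normed_carrier V by fact
  define \<Psi> where "\<Psi> = inv_into S \<Phi>"
  define M where "M x = inv_into (carr V) (D\<Phi> x)" for x
  have SV: "S \<subseteq> carr V" and TV: "T \<subseteq> carr V" using S T by (auto simp: nopen_def)
  have \<Psi>S: "\<Psi> w \<in> S" and \<Phi>\<Psi>: "\<Phi> (\<Psi> w) = w" if "w \<in> T" for w
    using bij that by (auto simp: \<Psi>_def bij_betw_def inv_into_into f_inv_into_f)
  have DL: "D\<Phi> x \<in> Lc V V" if "x \<in> S" for x
    using C1 that by (auto simp: C1_map_def frechet_derivative_at_def)
  have Minv: "M x \<in> Lc V V" if "x \<in> S" for x
    unfolding M_def by (rule inv_into_in_Lc[OF V DL Dbij Dexpand]) (use that in auto)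
  have DM: "D\<Phi> x (M x v) = v" if "x \<in> S" "v \<in> carr V" for x v
    using Dbij[OF that(1)] that(2) by (auto simp: M_def bij_betw_def f_inv_into_f)
  have MD: "M x (D\<Phi> x v) = v" if "x \<in> S" "v \<in> carr V" for x v
    using Dbij[OF that(1)] that(2) by (auto simp: M_def bij_betw_def)
  have Mb: "nrm V (M x v) \<le> K * nrm V v" if "x \<in> S" "v \<in> carr V" for x v
    using Dexpand[OF that(1) Lc_carr[OF Minv[OF that(1)] that(2)]] DM[OF that] by simp
  have lip: "nrm V (\<Psi> w - \<Psi> z) \<le> K * nrm V (w - z)" if "w \<in> T" "z \<in> T" for w z
    using expand[OF \<Psi>S \<Psi>S, OF that] \<Phi>\<Psi> that by simp
  have "C1_map V V T \<Psi> (\<lambda>w. M (\<Psi> w))"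
    unfolding C1_map_def
  proof (intro conjI ballI allI impI)
    fix w assume w: "w \<in> T"
    let ?x = "\<Psi> w"
    have x: "?x \<in> S" using \<Psi>S[OF w] .
    show "\<Psi> w \<in> carr V" using x SV by blast
    show "frechet_derivative_at V V T \<Psi> w (M ?x)"
      unfolding frechet_derivative_at_def
    proof (intro conjI allI impI)
      show "M ?x \<in> Lc V V" using Minv[OF x] .
      fix e :: real assume "e > 0"
      then have "e / (K * K) > 0" using \<open>K > 0\<close> by simp
      moreover have "frechet_derivative_at V V S \<Phi> ?x (D\<Phi> ?x)" using C1 x by (simp add: C1_map_def)
      ultimately obtain d where d: "d > 0" and
        diff: "\<And>y. y \<in> S \<Longrightarrow> nrm V (y - ?x) < d \<Longrightarrow>
          nrm V (\<Phi> y - \<Phi> ?x - D\<Phi> ?x (y - ?x)) \<le> e / (K * K) * nrm V (y - ?x)"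
        unfolding frechet_derivative_at_def by meson
      show "\<exists>d>0. \<forall>z\<in>T. nrm V (z - w) < d \<longrightarrow>
          nrm V (\<Psi> z - \<Psi> w - M ?x (z - w)) \<le> e * nrm V (z - w)"
      proof (intro exI[of _ "d / K"] conjI ballI impI)
        show "d / K > 0" using d \<open>K > 0\<close> by simp
        fix z assume z: "z \<in> T" and zw: "nrm V (z - w) < d / K"
        let ?y = "\<Psi> z"
        have y: "?y \<in> S" using \<Psi>S[OF z] .
        have carr: "?y \<in> carr V" "?x \<in> carr V" "z \<in> carr V" "w \<in> carr V"
          using x y z w SV TV by auto
        have Dc: "D\<Phi> ?x (?y - ?x) \<in> carr V" using carr by (intro Lc_carr[OF DL[OF x]]) simp
        have "nrm V (?y - ?x) \<le> K * nrm V (z - w)" using lip[OF z w] .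
        moreover have "K * nrm V (z - w) < d" using zw \<open>K > 0\<close> by (simp add: field_simps)
        ultimately have "nrm V (z - w - D\<Phi> ?x (?y - ?x)) \<le> e / (K * K) * nrm V (?y - ?x)"
          using diff[OF y] \<Phi>\<Psi> z w by simp
        also have "\<dots> \<le> e / (K * K) * (K * nrm V (z - w))"
          using lip[OF z w] \<open>e > 0\<close> \<open>K > 0\<close> by (intro mult_left_mono) auto
        finally have *: "K * nrm V (z - w - D\<Phi> ?x (?y - ?x)) \<le> e * nrm V (z - w)"
          using \<open>K > 0\<close> by (simp add: field_simps)
        have "M ?x (z - w - D\<Phi> ?x (?y - ?x)) = M ?x (z - w) - (?y - ?x)"
          using Lc_diff[OF V Minv[OF x]] MD[OF x] carr Dc by simp
        then have "nrm V (?y - ?x - M ?x (z - w)) = nrm V (M ?x (z - w - D\<Phi> ?x (?y - ?x)))"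
          using V.nrm_minus_commute[of "?y - ?x" "M ?x (z - w)"] carr Lc_carr[OF Minv[OF x]] by simp
        also have "\<dots> \<le> K * nrm V (z - w - D\<Phi> ?x (?y - ?x))"
          using Mb[OF x] carr Dc by simp
        finally show "nrm V (?y - ?x - M ?x (z - w)) \<le> e * nrm V (z - w)" using * by simp
      qed
    qed
    fix e :: real assume "e > 0"
    then have e': "e / (2 * K * K) > 0" using \<open>K > 0\<close> by simp
    then obtain d where d: "d > 0" and
      cont: "\<And>y. y \<in> S \<Longrightarrow> nrm V (y - ?x) < d \<Longrightarrow> opnorm V V (D\<Phi> y - D\<Phi> ?x) < e / (2 * K * K)"
      using C1 x unfolding C1_map_def by meson
    show "\<exists>d>0. \<forall>z\<in>T. nrm V (z - w) < d \<longrightarrow> opnorm V V (M (\<Psi> z) - M ?x) < e"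
    proof (intro exI[of _ "d / K"] conjI ballI impI)
      show "d / K > 0" using d \<open>K > 0\<close> by simp
      fix z assume z: "z \<in> T" and zw: "nrm V (z - w) < d / K"
      let ?y = "\<Psi> z"
      have y: "?y \<in> S" using \<Psi>S[OF z] .
      have "nrm V (?y - ?x) \<le> K * nrm V (z - w)" using lip[OF z w] .
      moreover have "K * nrm V (z - w) < d" using zw \<open>K > 0\<close> by (simp add: field_simps)
      ultimately have op: "opnorm V V (D\<Phi> ?y - D\<Phi> ?x) < e / (2 * K * K)" using cont[OF y] by simp
      have "opnorm V V (M ?y - M ?x) \<le> e / 2"
      proof (rule opnorm_le[OF V])
        show "0 \<le> e / 2" using \<open>e > 0\<close> by simp
        fix v assume v: "v \<in> carr V"
        let ?u = "M ?x v"
        have u: "?u \<in> carr V" using Lc_carr[OF Minv[OF x] v] .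
        have Du: "D\<Phi> ?y ?u \<in> carr V" using Lc_carr[OF DL[OF y] u] .
        \<comment> \<open>this is \<open>M\<^sub>y (D\<Phi>(y) - D\<Phi>(x)) M\<^sub>x = M\<^sub>x - M\<^sub>y\<close>, applied to \<open>v\<close>\<close>
        have "M ?y (D\<Phi> ?y ?u - D\<Phi> ?x ?u) = ?u - M ?y v"
          using Lc_diff[OF V Minv[OF y] Du v] MD[OF y u] DM[OF x v] by simp
        then have "nrm V ((M ?y - M ?x) v) = nrm V (M ?y (D\<Phi> ?y ?u - D\<Phi> ?x ?u))"
          using V.nrm_minus_commute[OF u Lc_carr[OF Minv[OF y] v]] by simp
        also have "\<dots> \<le> K * nrm V ((D\<Phi> ?y - D\<Phi> ?x) ?u)"
          using Mb[OF y, of "D\<Phi> ?y ?u - D\<Phi> ?x ?u"] Du Lc_carr[OF DL[OF x] u] by simp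
        also have "\<dots> \<le> K * (opnorm V V (D\<Phi> ?y - D\<Phi> ?x) * nrm V ?u)"
          using opnorm_bound[OF V V minus_in_Lc[OF V V DL[OF y] DL[OF x]] u] \<open>K > 0\<close>
          by (intro mult_left_mono) auto
        also have "\<dots> \<le> K * (e / (2 * K * K) * (K * nrm V v))"
          using op Mb[OF x v] \<open>K > 0\<close> V.nrm_nonneg[OF u] e'
          by (intro mult_left_mono mult_mono) auto
        also have "\<dots> = e / 2 * nrm V v" using \<open>K > 0\<close> by simp
        finally show "nrm V ((M ?y - M ?x) v) \<le> e / 2 * nrm V v" .
      qed
      then show "opnorm V V (M ?y - M ?x) < e" using \<open>e > 0\<close> by simp
    qed
  qed
  then show ?thesis
    unfolding C1_diffeo_def using S T bij C1 by (auto simp: \<Psi>_def)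
qed

section \<open>Straightening a level set\<close>

text \<open>
  The mean value inequality on the segment from \<open>y\<close> to \<open>x\<close>, for \<open>F\<close> minus its linearisation at a fixed
  point \<open>x0\<close>. Freezing the derivative at \<open>x0\<close> makes this one estimate serve for injectivity, for
  the Lipschitz bound of the inverse and for the contraction property.
\<close>

lemma strict_differentiability_bound:
  assumes V: "normed_carrier V" and H: "subspace H" and U: "U \<subseteq> carr V"
    and C1: "C1_map V (sub_nspace H) U F DF" and x0: "x0 \<in> U"
    and seg: "\<And>t. t \<in> {0..1} \<Longrightarrow> y + t *\<^sub>R (x - y) \<in> U \<and>
      opnorm V (sub_nspace H) (DF (y + t *\<^sub>R (x - y)) - DF x0) \<le> \<eta>"
  shows "norm (F x - F y - DF x0 (x - y)) \<le> \<eta> * nrm V (x - y)"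
proof -
  interpret V: normed_carrier V by fact
  have W: "normed_carrier (sub_nspace H)" by (rule normed_carrier_sub_nspace[OF H])
  define u where "u = x - y"
  define p where "p t = y + t *\<^sub>R u" for t
  define g where "g t = F (p t) - t *\<^sub>R DF x0 u" for t
  have pU: "p t \<in> U" and op: "opnorm V (sub_nspace H) (DF (p t) - DF x0) \<le> \<eta>" if "t \<in> {0..1}" for t
    using seg[OF that] by (auto simp: p_def u_def)
  have y: "y \<in> carr V" using pU[of 0] U by (auto simp: p_def)
  have x: "x \<in> carr V" using pU[of 1] U by (auto simp: p_def u_def)
  have u: "u \<in> carr V" using x y by (simp add: u_def)
  have fr: "frechet_derivative_at V (sub_nspace H) U F z (DF z)" if "z \<in> U" for z
    using C1 that by (simp add: C1_map_def)
  then have DL: "DF z \<in> Lc V (sub_nspace H)" if "z \<in> U" for z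
    using that by (simp add: frechet_derivative_at_def)
  have pdiff: "p s - p t = (s - t) *\<^sub>R u" for s t
    by (simp add: p_def scaleR_diff_left)
  have der: "((\<lambda>t. F (p t)) has_derivative (\<lambda>s. s *\<^sub>R DF (p t) u)) (at t within {0..1})"
    if t: "t \<in> {0..1}" for t
    unfolding has_derivative_within_alt
  proof (intro conjI allI impI)
    show "bounded_linear (\<lambda>s. s *\<^sub>R DF (p t) u)" by (rule bounded_linear_scaleR_left)
    fix e :: real assume "e > 0"
    \<comment> \<open>adding \<open>1\<close> allows division by \<open>k\<close> even if \<open>x = y\<close>\<close>
    define k where "k = nrm V u + 1"
    have k: "k > 0" using V.nrm_nonneg[OF u] by (simp add: k_def)
    then have "e / k > 0" using \<open>e > 0\<close> by simp
    then obtain d where d: "d > 0" and diff: "\<And>z. z \<in> U \<Longrightarrow> nrm V (z - p t) < d \<Longrightarrow>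
        norm (F z - F (p t) - DF (p t) (z - p t)) \<le> e / k * nrm V (z - p t)"
      using fr[OF pU[OF t]] unfolding frechet_derivative_at_def nrm_sub_nspace by meson
    show "\<exists>d>0. \<forall>s\<in>{0..1}. norm (s - t) < d \<longrightarrow>
        norm (F (p s) - F (p t) - (s - t) *\<^sub>R DF (p t) u) \<le> e * norm (s - t)"
    proof (intro exI[of _ "d / k"] conjI ballI impI)
      show "d / k > 0" using d k by simp
      fix s :: real assume s: "s \<in> {0..1}" and st: "norm (s - t) < d / k"
      have n: "nrm V (p s - p t) = \<bar>s - t\<bar> * nrm V u"
        unfolding pdiff by (rule V.nrm_scaleR[OF u])
      have le: "\<bar>s - t\<bar> * nrm V u \<le> \<bar>s - t\<bar> * k" by (intro mult_left_mono) (auto simp: k_def)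
      moreover have "\<bar>s - t\<bar> * k < d" using st k by (simp add: field_simps)
      ultimately have "norm (F (p s) - F (p t) - DF (p t) (p s - p t)) \<le> e / k * (\<bar>s - t\<bar> * nrm V u)"
        using diff[OF pU[OF s]] n by simp
      also have "\<dots> \<le> e / k * (\<bar>s - t\<bar> * k)"
        using \<open>e > 0\<close> k by (intro mult_left_mono[OF le]) auto
      also have "\<dots> = e * norm (s - t)" using k by simp
      finally show "norm (F (p s) - F (p t) - (s - t) *\<^sub>R DF (p t) u) \<le> e * norm (s - t)"
        using Lc_scaleR[OF DL[OF pU[OF t]] u] by (simp add: pdiff)
    qed
  qed
  have "norm (g 1 - g 0) \<le> (\<eta> * nrm V u) * norm (1 - 0 :: real)"
  proof (rule differentiable_bound)
    fix t :: real assume t: "t \<in> {0..1}"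
    show "(g has_derivative (\<lambda>s. s *\<^sub>R DF (p t) u - s *\<^sub>R DF x0 u)) (at t within {0..1})"
      unfolding g_def
      by (intro has_derivative_diff der[OF t] bounded_linear_imp_has_derivative bounded_linear_scaleR_left)
    have "norm ((DF (p t) - DF x0) u) \<le> opnorm V (sub_nspace H) (DF (p t) - DF x0) * nrm V u"
      using opnorm_bound[OF V W minus_in_Lc[OF V W DL[OF pU[OF t]] DL[OF x0]] u] by simp
    also have "\<dots> \<le> \<eta> * nrm V u" using op[OF t] V.nrm_nonneg[OF u] by (rule mult_right_mono)
    finally have *: "norm (DF (p t) u - DF x0 u) \<le> \<eta> * nrm V u" by simp
    show "onorm (\<lambda>s. s *\<^sub>R DF (p t) u - s *\<^sub>R DF x0 u) \<le> \<eta> * nrm V u"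
    proof (rule onorm_le)
      fix s :: real
      show "norm (s *\<^sub>R DF (p t) u - s *\<^sub>R DF x0 u) \<le> \<eta> * nrm V u * norm s"
        using mult_left_mono[OF *, of "\<bar>s\<bar>"] by (simp flip: scaleR_diff_right add: mult.commute)
    qed
  qed auto
  then show ?thesis by (simp add: g_def p_def u_def algebra_simps)
qed

lemma ball_nopen:
  assumes V: "normed_carrier V" and c: "c \<in> carr V"
  shows "nopen V {x \<in> carr V. nrm V (x - c) < \<delta>}"
proof -
  interpret V: normed_carrier V by fact
  have "nrm V (y - c) < \<delta>" if "x \<in> carr V" "y \<in> carr V" "nrm V (y - x) < \<delta> - nrm V (x - c)" for x y
    using V.nrm_triangle[of "y - x" "x - c"] that c by simp
  then show ?thesis unfolding nopen_def
    by (auto intro!: exI[of _ "\<delta> - nrm V (x - c)" for x])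
qed

lemma ball_convex:
  assumes V: "normed_carrier V" and c: "c \<in> carr V"
    and x: "x \<in> carr V" "nrm V (x - c) < \<delta>" and y: "y \<in> carr V" "nrm V (y - c) < \<delta>"
    and t: "t \<in> {0..1}"
  shows "y + t *\<^sub>R (x - y) \<in> carr V" "nrm V (y + t *\<^sub>R (x - y) - c) < \<delta>"
proof -
  interpret V: normed_carrier V by fact
  show "y + t *\<^sub>R (x - y) \<in> carr V" using x y by simp
  have "y + t *\<^sub>R (x - y) - c = (1 - t) *\<^sub>R (y - c) + t *\<^sub>R (x - c)"
    by (simp add: algebra_simps)
  then have "nrm V (y + t *\<^sub>R (x - y) - c) \<le> (1 - t) * nrm V (y - c) + t * nrm V (x - c)"
    using V.nrm_triangle[of "(1 - t) *\<^sub>R (y - c)" "t *\<^sub>R (x - c)"]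
      V.nrm_scaleR[of "y - c" "1 - t"] V.nrm_scaleR[of "x - c" t] x y c t by simp
  also have "\<dots> < \<delta>"
    using convex_bound_lt[of "nrm V (y - c)" \<delta> "nrm V (x - c)" "1 - t" t] x y t by simp
  finally show "nrm V (y + t *\<^sub>R (x - y) - c) < \<delta>" .
qed

text \<open>
  The bound on \<open>f 0\<close> is what keeps a \<open>c\<close>-contraction inside the ball of radius \<open>\<rho>\<close>:
  \<open>c * \<rho> + (1 - c) * \<rho> = \<rho>\<close>.
\<close>

lemma contraction_fixpoint_in_ball:
  fixes f :: "'w::banach \<Rightarrow> 'w"
  assumes H: "subspace H" "closed H" and c: "0 \<le> c" "c < 1" and "\<rho> \<ge> 0"
    and maps: "\<And>p. p \<in> H \<Longrightarrow> norm p \<le> \<rho> \<Longrightarrow> f p \<in> H"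
    and lip: "\<And>p q. p \<in> H \<Longrightarrow> norm p \<le> \<rho> \<Longrightarrow> q \<in> H \<Longrightarrow> norm q \<le> \<rho> \<Longrightarrow>
      norm (f p - f q) \<le> c * norm (p - q)"
    and f0: "norm (f 0) \<le> (1 - c) * \<rho>"
  obtains p where "p \<in> H" "norm p \<le> \<rho>" "f p = p"
proof -
  have "\<exists>!p\<in>H \<inter> cball 0 \<rho>. f p = p"
  proof (rule Banach_fix[OF _ _ c])
    show "complete (H \<inter> cball 0 \<rho>)" using H by (simp add: complete_eq_closed closed_Int)
    have 0: "0 \<in> H" using H(1) by (rule subspace_0)
    then show "H \<inter> cball 0 \<rho> \<noteq> {}" using \<open>\<rho> \<ge> 0\<close> by auto
    show "f ` (H \<inter> cball 0 \<rho>) \<subseteq> H \<inter> cball 0 \<rho>"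
    proof clarify
      fix p assume "p \<in> H" "p \<in> cball 0 \<rho>"
      then have p: "p \<in> H" "norm p \<le> \<rho>" by simp_all
      have "norm (f p) \<le> norm (f p - f 0) + norm (f 0)" by (metis diff_add_cancel norm_triangle_ineq)
      also have "\<dots> \<le> c * norm p + (1 - c) * \<rho>" using lip[OF p 0] f0 \<open>\<rho> \<ge> 0\<close> by simp
      also have "\<dots> \<le> c * \<rho> + (1 - c) * \<rho>" using p c by (intro add_right_mono mult_left_mono) auto
      finally show "f p \<in> H \<inter> cball 0 \<rho>" using maps[OF p] by (simp add: algebra_simps)
    qed
  qed (auto simp: dist_norm lip)
  then show ?thesis using that by auto
qed

text \<open>
  Inverting \<open>I - J L\<close> on \<open>V\<close> amounts to inverting \<open>I - L J\<close> on \<open>H\<close>: a solution of \<open>u - J (L u) = v\<close> has the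
  form \<open>u = v + J q\<close> with \<open>q = L u\<close>, that is \<open>q = L (v + J q)\<close>, and this affine map is a contraction of \<open>H\<close>.
\<close>

lemma bij_minus_factored_contraction:
  fixes H :: "'w::banach set"
  assumes V: "normed_carrier V" and H: "subspace H" "closed H"
    and J: "J \<in> Lc (sub_nspace H) V" and L: "L \<in> Lc V (sub_nspace H)"
    and b: "b \<ge> 0" "\<And>q. q \<in> H \<Longrightarrow> nrm V (J q) \<le> b * norm q"
    and k: "k \<ge> 0" "\<And>v. v \<in> carr V \<Longrightarrow> norm (L v) \<le> k * nrm V v"
    and c: "0 \<le> c" "c < 1" "\<And>q. q \<in> H \<Longrightarrow> norm (L (J q)) \<le> c * norm q"
  shows "bij_betw (\<lambda>v. v - J (L v)) (carr V) (carr V)"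
    and "\<And>u. u \<in> carr V \<Longrightarrow> nrm V u \<le> (1 + b * (k / (1 - c))) * nrm V (u - J (L u))"
proof -
  interpret V: normed_carrier V by fact
  have W: "normed_carrier (sub_nspace H)" by (rule normed_carrier_sub_nspace[OF H(1)])
  have JV: "J q \<in> carr V" if "q \<in> H" for q using Lc_carr[OF J] that by simp
  have LH: "L v \<in> H" if "v \<in> carr V" for v using Lc_carr[OF L that] by simp
  show bound: "nrm V u \<le> (1 + b * (k / (1 - c))) * nrm V (u - J (L u))" if u: "u \<in> carr V" for u
  proof -
    let ?v = "u - J (L u)"
    have v: "?v \<in> carr V" using u JV LH by simp
    have "L u = L ?v + L (J (L u))" using Lc_diff[OF V L u JV[OF LH[OF u]]] by simp
    then have "norm (L u) \<le> norm (L ?v) + norm (L (J (L u)))" by (metis norm_triangle_ineq)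
    also have "\<dots> \<le> k * nrm V ?v + c * norm (L u)" using k(2)[OF v] c(3)[OF LH[OF u]] by simp
    finally have "norm (L u) \<le> k / (1 - c) * nrm V ?v" using c by (simp add: field_simps)
    then have *: "b * norm (L u) \<le> b * (k / (1 - c)) * nrm V ?v"
      using mult_left_mono[of "norm (L u)" "k / (1 - c) * nrm V ?v" b] b(1) by (simp add: mult.assoc)
    have "nrm V u \<le> nrm V ?v + nrm V (J (L u))"
      using V.nrm_triangle[OF v JV[OF LH[OF u]]] by simp
    then show ?thesis using b(2)[OF LH[OF u]] * by (simp add: algebra_simps)
  qed
  show "bij_betw (\<lambda>v. v - J (L v)) (carr V) (carr V)"
    unfolding bij_betw_def
  proof
    show "inj_on (\<lambda>v. v - J (L v)) (carr V)"
    proof (rule inj_onI)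
      fix u v assume uv: "u \<in> carr V" "v \<in> carr V" "u - J (L u) = v - J (L v)"
      have "u - v - J (L (u - v)) = (u - J (L u)) - (v - J (L v))"
        using Lc_diff[OF V L] Lc_diff[OF W J, of "L u" "L v"] LH uv(1,2) by simp
      then have "u - v - J (L (u - v)) = 0" using uv(3) by simp
      then have "nrm V (u - v) \<le> 0" using bound[of "u - v"] uv(1,2) by simp
      then show "u = v" using V.nrm_eq_0[of "u - v"] V.nrm_nonneg[of "u - v"] uv(1,2) by simp
    qed
    show "(\<lambda>v. v - J (L v)) ` carr V = carr V"
    proof
      show "(\<lambda>v. v - J (L v)) ` carr V \<subseteq> carr V" using JV LH by auto
      show "carr V \<subseteq> (\<lambda>v. v - J (L v)) ` carr V"
      proof
        fix v assume v: "v \<in> carr V"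
        obtain q where q: "q \<in> H" "L (v + J q) = q"
        proof (rule contraction_fixpoint_in_ball[OF H c(1,2), of "norm (L v) / (1 - c)" "\<lambda>q. L (v + J q)"])
          show "0 \<le> norm (L v) / (1 - c)" using c by simp
          show "L (v + J q) \<in> H" if "q \<in> H" for q using v JV LH that by simp
          show "norm (L (v + J p) - L (v + J q)) \<le> c * norm (p - q)" if "p \<in> H" "q \<in> H" for p q
            using c(3)[of "p - q"] Lc_diff[OF V L, of "v + J p" "v + J q"] Lc_diff[OF W J, of p q]
              v JV that subspace_diff[OF H(1)] by simp
          show "norm (L (v + J 0)) \<le> (1 - c) * (norm (L v) / (1 - c))"
            using c Lc_zero[OF W J] by simp
        qed (use that in blast)
        then have "v = (v + J q) - J (L (v + J q))" by simp
        then show "v \<in> (\<lambda>v. v - J (L v)) ` carr V" using v JV q(1) by (intro image_eqI[where x = "v + J q"]) auto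
      qed
    qed
  qed
qed

text \<open>
  The inverse function theorem for \<open>\<Phi> x = x - x0 - J (F x - F x0)\<close>. Near \<open>x0\<close> the map \<open>F\<close> is within \<open>\<eta>\<close>
  of its linearisation at \<open>x0\<close>, so \<open>F\<close> composed with \<open>J\<close> contracts with the factor \<open>c' = c + \<eta> * b\<close>, where
  \<open>b\<close> bounds \<open>J\<close>. If \<open>x - y = v + J p\<close> with \<open>v = \<Phi> x - \<Phi> y\<close> and \<open>p = F x - F y\<close>, the contraction bounds \<open>p\<close>
  by \<open>v\<close>; this gives injectivity and the Lipschitz bound of the inverse. Conversely, solving
  \<open>\<Phi> y = \<Phi> x + v\<close> for small \<open>v\<close> is the fixed point problem \<open>p = F (x + v + J p) - F x\<close> in \<open>H\<close>, which shows
  that the image is open.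
\<close>

lemma perturbed_identity_C1_diffeo:
  fixes H :: "'w::banach set"
  assumes V: "normed_carrier V" and H: "subspace H" "closed H"
    and U: "nopen V U" and C1: "C1_map V (sub_nspace H) U F DF" and x0: "x0 \<in> U"
    and J: "J \<in> Lc (sub_nspace H) V"
    and c: "0 \<le> c" "c < 1" "\<And>q. q \<in> H \<Longrightarrow> norm (DF x0 (J q)) \<le> c * norm q"
  obtains S T where "x0 \<in> S" "S \<subseteq> U" "C1_diffeo V V S T (\<lambda>x. x - x0 - J (F x - F x0))"
proof -
  interpret V: normed_carrier V by fact
  have W: "normed_carrier (sub_nspace H)" by (rule normed_carrier_sub_nspace[OF H(1)])
  define \<Phi> where "\<Phi> x = x - x0 - J (F x - F x0)" for x
  have UV: "U \<subseteq> carr V" using U by (simp add: nopen_def)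
  have x0V: "x0 \<in> carr V" using x0 UV by blast
  have FH: "F x \<in> H" if "x \<in> U" for x using C1 that by (simp add: C1_map_def)
  have fr: "frechet_derivative_at V (sub_nspace H) U F z (DF z)" if "z \<in> U" for z
    using C1 that by (simp add: C1_map_def)
  then have DL: "DF z \<in> Lc V (sub_nspace H)" if "z \<in> U" for z
    using that by (simp add: frechet_derivative_at_def)
  have JV: "J q \<in> carr V" if "q \<in> H" for q using Lc_carr[OF J] that by simp
  have Jdiff: "J (p - q) = J p - J q" if "p \<in> H" "q \<in> H" for p q
    using Lc_diff[OF W J] that by simp
  have LH: "DF x v \<in> H" if "x \<in> U" "v \<in> carr V" for x v using Lc_carr[OF DL] that by simp
  obtain b where b: "b > 0" "\<And>q. q \<in> H \<Longrightarrow> nrm V (J q) \<le> b * norm q"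
    using Lc_bounded[OF W J] by auto
  obtain k0 where k0: "k0 > 0" "\<And>v. v \<in> carr V \<Longrightarrow> norm (DF x0 v) \<le> k0 * nrm V v"
    using Lc_bounded[OF V DL[OF x0]] by auto
  \<comment> \<open>chosen so that \<open>c' = (1 + c) / 2 < 1\<close>\<close>
  define \<eta> where "\<eta> = (1 - c) / 2 / b"
  define c' where "c' = c + \<eta> * b"
  define k where "k = k0 + \<eta>"
  have \<eta>: "\<eta> > 0" using c b by (simp add: \<eta>_def)
  have c': "0 \<le> c'" "c' < 1" using c b by (simp_all add: c'_def \<eta>_def field_simps)
  have k: "k > 0" using k0 \<eta> by (simp add: k_def)
  obtain d1 where d1: "d1 > 0" "\<And>y. y \<in> carr V \<Longrightarrow> nrm V (y - x0) < d1 \<Longrightarrow> y \<in> U"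
    using U x0 unfolding nopen_def by meson
  obtain d2 where d2: "d2 > 0"
    "\<And>y. y \<in> U \<Longrightarrow> nrm V (y - x0) < d2 \<Longrightarrow> opnorm V (sub_nspace H) (DF y - DF x0) < \<eta>"
    using C1 x0 \<eta> unfolding C1_map_def by meson
  define \<delta> where "\<delta> = min d1 d2"
  define S where "S = {x \<in> carr V. nrm V (x - x0) < \<delta>}"
  have SU: "S \<subseteq> U" using d1 by (auto simp: S_def \<delta>_def)
  have SV: "S \<subseteq> carr V" by (auto simp: S_def)
  have x0S: "x0 \<in> S" using d1 d2 x0V by (simp add: S_def \<delta>_def)
  have op: "opnorm V (sub_nspace H) (DF x - DF x0) \<le> \<eta>" if "x \<in> S" for x
    using d2(2)[of x] SU that by (force simp: S_def \<delta>_def)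
  have strict: "norm (F x - F y - DF x0 (x - y)) \<le> \<eta> * nrm V (x - y)" if "x \<in> S" "y \<in> S" for x y
  proof (rule strict_differentiability_bound[OF V H(1) UV C1 x0])
    fix t :: real assume t: "t \<in> {0..1}"
    have "y + t *\<^sub>R (x - y) \<in> S"
      using ball_convex[OF V x0V _ _ _ _ t, of x \<delta> y] that by (simp add: S_def)
    then show "y + t *\<^sub>R (x - y) \<in> U \<and>
        opnorm V (sub_nspace H) (DF (y + t *\<^sub>R (x - y)) - DF x0) \<le> \<eta>"
      using op SU by blast
  qed
  have DF_near: "norm (DF x v - DF x0 v) \<le> \<eta> * nrm V v" if "x \<in> S" "v \<in> carr V" for x v
  proof -
    have "norm ((DF x - DF x0) v) \<le> opnorm V (sub_nspace H) (DF x - DF x0) * nrm V v"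
      using opnorm_bound[OF V W minus_in_Lc[OF V W DL DL] that(2), of x x0] x0 SU that by auto
    also have "\<dots> \<le> \<eta> * nrm V v" using op[OF that(1)] V.nrm_nonneg[OF that(2)] by (rule mult_right_mono)
    finally show ?thesis by simp
  qed
  have DF_bound: "norm (DF x v) \<le> k * nrm V v" if "x \<in> S" "v \<in> carr V" for x v
    using norm_triangle_sub[of "DF x v" "DF x0 v"] DF_near[OF that] k0(2)[OF that(2)]
    by (simp add: k_def algebra_simps)
  have eta_J: "\<eta> * nrm V (J q) \<le> \<eta> * b * norm q" if "q \<in> H" for q
    using mult_left_mono[OF b(2)[OF that], of \<eta>] \<eta> by (simp add: mult.assoc)
  have DFJ: "norm (DF x (J q)) \<le> c' * norm q" if "x \<in> S" "q \<in> H" for x q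
    using norm_triangle_sub[of "DF x (J q)" "DF x0 (J q)"] DF_near[OF that(1) JV[OF that(2)]]
      c(3)[OF that(2)] eta_J[OF that(2)]
    by (simp add: c'_def algebra_simps)
  define K where "K = 1 + b * (k / (1 - c'))"
  have K: "K > 0" using b k c' by (simp add: K_def add_pos_pos)
  have \<Phi>diff: "\<Phi> x - \<Phi> y = (x - y) - J (F x - F y)" if "x \<in> S" "y \<in> S" for x y
    using Jdiff[of "F x - F x0" "F y - F x0"] FH x0 SU that subspace_diff[OF H(1)]
    by (auto simp: \<Phi>_def subset_iff)
  have expand: "nrm V (x - y) \<le> K * nrm V (\<Phi> x - \<Phi> y)" if xy: "x \<in> S" "y \<in> S" for x y
  proof -
    define p where "p = F x - F y"
    define v where "v = \<Phi> x - \<Phi> y"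
    have p: "p \<in> H" unfolding p_def using FH SU xy subspace_diff[OF H(1)] by blast
    have xyv: "x - y = v + J p" using \<Phi>diff[OF xy] by (simp add: v_def p_def)
    have "x - y \<in> carr V" using xy SV by (intro V.diff_carr) auto
    then have "x - y - J p \<in> carr V" using JV[OF p] by simp
    then have v: "v \<in> carr V" by (simp add: xyv)
    have n: "nrm V (x - y) \<le> nrm V v + nrm V (J p)"
      unfolding xyv by (rule V.nrm_triangle[OF v JV[OF p]])
    have "norm p \<le> norm (DF x0 (x - y)) + \<eta> * nrm V (x - y)"
      using norm_triangle_sub[of p "DF x0 (x - y)"] strict[OF xy] by (simp add: p_def)
    also have "DF x0 (x - y) = DF x0 v + DF x0 (J p)"
      unfolding xyv by (rule Lc_add[OF DL[OF x0] v JV[OF p]])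
    also have "norm \<dots> \<le> k0 * nrm V v + c * norm p"
      using k0(2)[OF v] c(3)[OF p] norm_triangle_ineq[of "DF x0 v" "DF x0 (J p)"] by linarith
    also have "\<eta> * nrm V (x - y) \<le> \<eta> * nrm V v + \<eta> * b * norm p"
      using mult_left_mono[OF n, of \<eta>] eta_J[OF p] \<eta> unfolding distrib_left by linarith
    finally have "norm p \<le> k * nrm V v + c' * norm p" by (simp add: k_def c'_def algebra_simps)
    then have "norm p \<le> k / (1 - c') * nrm V v" using c' by (simp add: field_simps)
    then have "b * norm p \<le> b * (k / (1 - c')) * nrm V v"
      using mult_left_mono[of "norm p" "k / (1 - c') * nrm V v" b] b(1) by (simp add: mult.assoc)
    then have "nrm V (x - y) \<le> K * nrm V v" using n b(2)[OF p] by (simp add: K_def algebra_simps)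
    then show ?thesis by (simp add: v_def)
  qed
  have inj: "inj_on \<Phi> S"
  proof (rule inj_onI)
    fix x y assume xy: "x \<in> S" "y \<in> S" "\<Phi> x = \<Phi> y"
    have d: "x - y \<in> carr V" using xy SV by (intro V.diff_carr) auto
    show "x = y"
      using expand[OF xy(1,2)] V.nrm_eq_0[OF d] V.nrm_nonneg[OF d] xy(3) by simp
  qed
  have Sopen: "nopen V S" unfolding S_def by (rule ball_nopen[OF V x0V])
  have \<Phi>V: "\<Phi> x \<in> carr V" if "x \<in> S" for x
  proof -
    have "x \<in> carr V" "x \<in> U" using that SV SU by auto
    then show ?thesis
      unfolding \<Phi>_def using x0V JV[OF subspace_diff[OF H(1) FH FH[OF x0]], of x] by simp
  qed
  have Topen: "nopen V (\<Phi> ` S)"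
    unfolding nopen_def
  proof (intro conjI ballI)
    show "\<Phi> ` S \<subseteq> carr V" using \<Phi>V by blast
    fix w assume "w \<in> \<Phi> ` S"
    then obtain x where x: "x \<in> S" "w = \<Phi> x" by blast
    have xV: "x \<in> carr V" using x SV by blast
    \<comment> \<open>a displacement \<open>v\<close> moves the solution by at most \<open>K * nrm V v\<close>, which has to stay in the ball \<open>S\<close>\<close>
    define s where "s = (\<delta> - nrm V (x - x0)) / K"
    have s: "s > 0" using x K by (simp add: s_def S_def)
    show "\<exists>e>0. \<forall>z\<in>carr V. nrm V (z - w) < e \<longrightarrow> z \<in> \<Phi> ` S"
    proof (intro exI[of _ s] conjI ballI impI s)
      fix z assume z: "z \<in> carr V" and zw: "nrm V (z - w) < s"
      define v where "v = z - w"
      define \<rho> where "\<rho> = k / (1 - c') * nrm V v"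
      have v: "v \<in> carr V" unfolding v_def x(2) by (rule V.diff_carr[OF z \<Phi>V[OF x(1)]])
      have \<rho>: "\<rho> \<ge> 0" using k c' V.nrm_nonneg[OF v] by (simp add: \<rho>_def)
      have inS: "x + v + J p \<in> S" if p: "p \<in> H" "norm p \<le> \<rho>" for p
      proof -
        have "nrm V (x + v + J p - x0) \<le> nrm V (x - x0) + (nrm V v + nrm V (J p))"
          using V.nrm_triangle[of "x - x0" "v + J p"] V.nrm_triangle[OF v JV[OF p(1)]]
            xV x0V v JV[OF p(1)] by (simp add: algebra_simps)
        also have "nrm V (J p) \<le> b * \<rho>"
          by (rule order.trans[OF b(2)[OF p(1)] mult_left_mono[OF p(2) less_imp_le[OF b(1)]]])
        also have "nrm V (x - x0) + (nrm V v + b * \<rho>) = nrm V (x - x0) + K * nrm V v"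
          by (simp add: K_def \<rho>_def algebra_simps)
        also have "\<dots> < \<delta>" using zw K by (simp add: v_def s_def field_simps)
        finally show ?thesis using xV v JV[OF p(1)] by (simp add: S_def)
      qed
      obtain p where p: "p \<in> H" "norm p \<le> \<rho>" "F (x + v + J p) - F x = p"
      proof (rule contraction_fixpoint_in_ball[OF H c' \<rho>, of "\<lambda>p. F (x + v + J p) - F x"])
        show "F (x + v + J p) - F x \<in> H" if "p \<in> H" "norm p \<le> \<rho>" for p
          using inS[OF that] x(1) SU FH subspace_diff[OF H(1)] by blast
        show "norm (F (x + v + J p) - F x - (F (x + v + J q) - F x)) \<le> c' * norm (p - q)"
          if p: "p \<in> H" "norm p \<le> \<rho>" and q: "q \<in> H" "norm q \<le> \<rho>" for p q
        proof -
          have pq: "p - q \<in> H" using p q subspace_diff[OF H(1)] by blast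
          have "norm (F (x + v + J p) - F (x + v + J q)) \<le> norm (DF x0 (J (p - q))) + \<eta> * nrm V (J (p - q))"
            using norm_triangle_sub[of "F (x + v + J p) - F (x + v + J q)" "DF x0 (J (p - q))"]
              strict[OF inS[OF p] inS[OF q]] Jdiff[OF p(1) q(1)] by simp
          then show ?thesis using c(3)[OF pq] eta_J[OF pq] by (simp add: c'_def algebra_simps)
        qed
        have 0: "0 \<in> H" using H(1) by (rule subspace_0)
        have "x + v \<in> S" using inS[OF 0] \<rho> Lc_zero[OF W J] by simp
        then have "norm (F (x + v) - F x) \<le> k0 * nrm V v + \<eta> * nrm V v"
          using norm_triangle_sub[of "F (x + v) - F x" "DF x0 v"] strict[of "x + v" x] x(1) k0(2)[OF v]
          by simp
        moreover have "(1 - c') * \<rho> = k0 * nrm V v + \<eta> * nrm V v"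
          using c' by (simp add: \<rho>_def k_def distrib_right)
        ultimately show "norm (F (x + v + J 0) - F x) \<le> (1 - c') * \<rho>"
          using Lc_zero[OF W J] by simp
      qed (use that in blast)
      have y: "x + v + J p \<in> S" by (rule inS[OF p(1,2)])
      have "\<Phi> (x + v + J p) - \<Phi> x = v" using \<Phi>diff[OF y x(1)] p(3) by simp
      then have "z = \<Phi> (x + v + J p)" by (simp add: v_def x(2))
      then show "z \<in> \<Phi> ` S" using y by blast
    qed
  qed
  define D\<Phi> where "D\<Phi> x v = v - J (DF x v)" for x v
  have C1\<Phi>: "C1_map V V S \<Phi> D\<Phi>"
    unfolding C1_map_def
  proof (intro conjI ballI allI impI)
    fix x assume x: "x \<in> S"
    then have xU: "x \<in> U" using SU by blast
    show "\<Phi> x \<in> carr V" by (rule \<Phi>V[OF x])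
    have "(\<lambda>v. J (DF x v)) \<in> Lc V V" by (rule compose_in_Lc[OF V W DL[OF xU] J])
    moreover have "(\<lambda>v. v) \<in> Lc V V" by (rule LcI[where K = 1]) auto
    ultimately have DLc: "D\<Phi> x \<in> Lc V V"
      using minus_in_Lc[OF V V, of "\<lambda>v. v" "\<lambda>v. J (DF x v)"] by (simp add: D\<Phi>_def[abs_def] fun_diff_def)
    show "frechet_derivative_at V V S \<Phi> x (D\<Phi> x)"
      unfolding frechet_derivative_at_def
    proof (intro conjI allI impI DLc)
      fix e :: real assume "e > 0"
      then have "e / b > 0" using b by simp
      then obtain d where d: "d > 0" and diff: "\<And>y. y \<in> U \<Longrightarrow> nrm V (y - x) < d \<Longrightarrow>
          norm (F y - F x - DF x (y - x)) \<le> e / b * nrm V (y - x)"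
        using fr[OF xU] unfolding frechet_derivative_at_def nrm_sub_nspace by meson
      show "\<exists>d>0. \<forall>y\<in>S. nrm V (y - x) < d \<longrightarrow> nrm V (\<Phi> y - \<Phi> x - D\<Phi> x (y - x)) \<le> e * nrm V (y - x)"
      proof (intro exI[of _ d] conjI ballI impI d)
        fix y assume y: "y \<in> S" and yx: "nrm V (y - x) < d"
        let ?q = "F y - F x - DF x (y - x)"
        have yxV: "y - x \<in> carr V" using x y SV by (intro V.diff_carr) auto
        have FF: "F y - F x \<in> H" using FH SU x y subspace_diff[OF H(1)] by blast
        have q: "?q \<in> H" using subspace_diff[OF H(1) FF LH[OF xU yxV]] .
        have "\<Phi> y - \<Phi> x - D\<Phi> x (y - x) = - J ?q"
          using \<Phi>diff[OF y x] Jdiff[OF FF LH[OF xU yxV]] by (simp add: D\<Phi>_def)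
        then have "nrm V (\<Phi> y - \<Phi> x - D\<Phi> x (y - x)) = nrm V (J ?q)"
          using V.nrm_scaleR[OF JV[OF q], of "-1"] by simp
        also have "\<dots> \<le> b * norm ?q" by (rule b(2)[OF q])
        also have "\<dots> \<le> b * (e / b * nrm V (y - x))"
          using diff[of y] y SU yx b(1) by (intro mult_left_mono) auto
        finally show "nrm V (\<Phi> y - \<Phi> x - D\<Phi> x (y - x)) \<le> e * nrm V (y - x)" using b(1) by simp
      qed
    qed
    fix e :: real assume "e > 0"
    then have "e / (2 * b) > 0" using b by simp
    then obtain d where d: "d > 0" and cont: "\<And>y. y \<in> U \<Longrightarrow> nrm V (y - x) < d \<Longrightarrow>
        opnorm V (sub_nspace H) (DF y - DF x) < e / (2 * b)"
      using C1 xU unfolding C1_map_def by meson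
    show "\<exists>d>0. \<forall>y\<in>S. nrm V (y - x) < d \<longrightarrow> opnorm V V (D\<Phi> y - D\<Phi> x) < e"
    proof (intro exI[of _ d] conjI ballI impI d)
      fix y assume y: "y \<in> S" and yx: "nrm V (y - x) < d"
      have yU: "y \<in> U" using y SU by blast
      have "opnorm V V (D\<Phi> y - D\<Phi> x) \<le> e / 2"
      proof (rule opnorm_le[OF V])
        show "0 \<le> e / 2" using \<open>e > 0\<close> by simp
        fix v assume v: "v \<in> carr V"
        let ?q = "DF x v - DF y v"
        have q: "?q \<in> H" using subspace_diff[OF H(1) LH[OF xU v] LH[OF yU v]] .
        have "(D\<Phi> y - D\<Phi> x) v = J ?q"
          using Jdiff[OF LH[OF xU v] LH[OF yU v]] by (simp add: D\<Phi>_def)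
        then have "nrm V ((D\<Phi> y - D\<Phi> x) v) \<le> b * norm ((DF y - DF x) v)"
          using b(2)[OF q] by (simp add: norm_minus_commute)
        also have "\<dots> \<le> b * (opnorm V (sub_nspace H) (DF y - DF x) * nrm V v)"
          using opnorm_bound[OF V W minus_in_Lc[OF V W DL[OF yU] DL[OF xU]] v] b(1)
          by (intro mult_left_mono) auto
        also have "\<dots> \<le> b * (e / (2 * b) * nrm V v)"
          using cont[OF yU yx] b(1) V.nrm_nonneg[OF v] by (intro mult_left_mono mult_right_mono) auto
        also have "\<dots> = e / 2 * nrm V v" using b(1) by simp
        finally show "nrm V ((D\<Phi> y - D\<Phi> x) v) \<le> e / 2 * nrm V v" .
      qed
      then show "opnorm V V (D\<Phi> y - D\<Phi> x) < e" using \<open>e > 0\<close> by simp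
    qed
  qed
  have "C1_diffeo V V S (\<Phi> ` S) \<Phi>"
  proof (rule C1_diffeoI[OF V Sopen Topen _ C1\<Phi> K expand])
    show "bij_betw \<Phi> S (\<Phi> ` S)" using inj by (rule inj_on_imp_bij_betw)
    fix x assume x: "x \<in> S"
    then have xU: "x \<in> U" using SU by blast
    note bij = bij_minus_factored_contraction[OF V H J DL[OF xU] less_imp_le[OF b(1)] b(2)
        less_imp_le[OF k] DF_bound[OF x] c' DFJ[OF x], folded D\<Phi>_def K_def]
    show "bij_betw (D\<Phi> x) (carr V) (carr V)" using bij(1) by (simp add: D\<Phi>_def[abs_def])
    show "nrm V u \<le> K * nrm V (D\<Phi> x u)" if "u \<in> carr V" for u by (rule bij(2)[OF _ _ _ that])
  qed
  then show ?thesis using that[OF x0S SU] unfolding \<Phi>_def[abs_def] by blast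
qed

text \<open>
  A right inverse \<open>J\<close> of \<open>\<Lambda>\<close> with \<open>\<parallel>DF(x) J\<parallel> < 1\<close> makes the previous diffeomorphism \<open>\<Phi>\<close> available, and \<open>\<Lambda> (\<Phi> x) = \<Lambda> x - F x\<close> shows that
  it is a chart. The kernel of \<open>\<Lambda>\<close> is complemented by the range of \<open>J\<close>, the kernel of \<open>I - J \<Lambda>\<close>.
\<close>

theorem level_set_C1_submanifold:
  fixes H :: "'w::banach set"
  assumes V: "normed_carrier V" and H: "subspace H" "closed H"
    and U: "nopen V U" and C1: "C1_map V (sub_nspace H) U F DF"
    and \<Lambda>: "\<Lambda> \<in> Lc V (sub_nspace H)"
    and J: "\<And>x. x \<in> U \<Longrightarrow> \<Lambda> x = F x \<Longrightarrow> \<exists>J\<in>Lc (sub_nspace H) V. \<exists>c. 0 \<le> c \<and> c < 1 \<and>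
      (\<forall>q\<in>H. \<Lambda> (J q) = q \<and> norm (DF x (J q)) \<le> c * norm q)"
  shows "C1_submanifold V {x \<in> U. \<Lambda> x = F x}"
  unfolding C1_submanifold_def
proof (intro conjI ballI)
  interpret V: normed_carrier V by fact
  have W: "normed_carrier (sub_nspace H)" by (rule normed_carrier_sub_nspace[OF H(1)])
  have UV: "U \<subseteq> carr V" using U by (simp add: nopen_def)
  then show "{x \<in> U. \<Lambda> x = F x} \<subseteq> carr V" by blast
  fix x0 assume "x0 \<in> {x \<in> U. \<Lambda> x = F x}"
  then have x0: "x0 \<in> U" "\<Lambda> x0 = F x0" by auto
  obtain J c where J: "J \<in> Lc (sub_nspace H) V" and c: "0 \<le> c" "c < 1"
    and \<Lambda>J: "\<And>q. q \<in> H \<Longrightarrow> \<Lambda> (J q) = q" and DFJ: "\<And>q. q \<in> H \<Longrightarrow> norm (DF x0 (J q)) \<le> c * norm q"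
    using J[OF x0] by blast
  define \<Phi> where "\<Phi> x = x - x0 - J (F x - F x0)" for x
  obtain S T where S: "x0 \<in> S" "S \<subseteq> U" and diffeo: "C1_diffeo V V S T \<Phi>"
    using perturbed_identity_C1_diffeo[OF V H U C1 x0(1) J c DFJ] unfolding \<Phi>_def[abs_def] by blast
  have JV: "J q \<in> carr V" if "q \<in> H" for q using Lc_carr[OF J] that by simp
  have \<Lambda>H: "\<Lambda> v \<in> H" if "v \<in> carr V" for v using Lc_carr[OF \<Lambda> that] by simp
  have FH: "F x \<in> H" if "x \<in> U" for x using C1 that by (simp add: C1_map_def)
  obtain a where a: "a > 0" "\<And>v. v \<in> carr V \<Longrightarrow> norm (\<Lambda> v) \<le> a * nrm V v"
    using Lc_bounded[OF V \<Lambda>] by auto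
  obtain b where b: "b > 0" "\<And>q. q \<in> H \<Longrightarrow> nrm V (J q) \<le> b * norm q"
    using Lc_bounded[OF W J] by auto
  define Y where "Y = {v \<in> carr V. \<Lambda> v = 0}"
  define Z where "Z = J ` H"
  have P: "v - J (\<Lambda> v) \<in> Y" if "v \<in> carr V" for v
    using that JV[OF \<Lambda>H] Lc_diff[OF V \<Lambda> that JV[OF \<Lambda>H]] \<Lambda>J[OF \<Lambda>H] by (simp add: Y_def)
  have Zeq: "Z = {v \<in> carr V. v - J (\<Lambda> v) = 0}"
    using JV \<Lambda>J \<Lambda>H by (force simp: Z_def)
  have PLc: "(\<lambda>v. v - J (\<Lambda> v)) \<in> Lc V V"
  proof -
    have "(\<lambda>v. v) \<in> Lc V V" by (rule LcI[where K = 1]) auto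
    from minus_in_Lc[OF V V this compose_in_Lc[OF V W \<Lambda> J]] show ?thesis by (simp add: fun_diff_def)
  qed
  \<comment> \<open>both summands are kernels of bounded operators\<close>
  have "closed_splitting V Y Z"
    unfolding closed_splitting_def
  proof (intro conjI)
    show "subspace Y" unfolding Y_def by (rule kernel_subspace[OF V \<Lambda>])
    show "subspace Z" unfolding Zeq by (rule kernel_subspace[OF V PLc])
    show "nclosed V Y" unfolding Y_def by (rule kernel_nclosed[OF V W \<Lambda>])
    show "nclosed V Z" unfolding Zeq by (rule kernel_nclosed[OF V V PLc])
    show "Y \<inter> Z = {0}"
      using Lc_zero[OF V \<Lambda>] Lc_zero[OF W J] by (auto simp: Y_def Zeq)
    show "carr V = {y + z |y z. y \<in> Y \<and> z \<in> Z}"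
    proof
      show "carr V \<subseteq> {y + z |y z. y \<in> Y \<and> z \<in> Z}"
      proof
        fix v assume v: "v \<in> carr V"
        have "v = (v - J (\<Lambda> v)) + J (\<Lambda> v)" by simp
        then show "v \<in> {y + z |y z. y \<in> Y \<and> z \<in> Z}"
          using P[OF v] \<Lambda>H[OF v] unfolding Z_def by blast
      qed
    qed (auto simp: Y_def Zeq)
  qed
  moreover have "\<Phi> ` ({x \<in> U. \<Lambda> x = F x} \<inter> S) = Y \<inter> T"
  proof -
    have bij: "\<Phi> ` S = T" using diffeo by (simp add: C1_diffeo_def bij_betw_def)
    have "\<Phi> x \<in> Y \<longleftrightarrow> \<Lambda> x = F x" if x: "x \<in> S" for x
    proof -
      have xU: "x \<in> U" using x S by blast
      have q: "F x - F x0 \<in> H" by (rule subspace_diff[OF H(1) FH[OF xU] FH[OF x0(1)]])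
      have xV: "x \<in> carr V" "x0 \<in> carr V" using xU x0 UV by auto
      have "\<Lambda> (\<Phi> x) = \<Lambda> x - F x"
        using Lc_diff[OF V \<Lambda>, of "x - x0" "J (F x - F x0)"] Lc_diff[OF V \<Lambda> xV] \<Lambda>J[OF q] JV[OF q] xV x0(2)
        by (simp add: \<Phi>_def)
      moreover have "\<Phi> x \<in> carr V" using xV JV[OF q] by (simp add: \<Phi>_def)
      ultimately show ?thesis by (simp add: Y_def)
    qed
    then show ?thesis using bij S(2) by blast
  qed
  ultimately show "\<exists>Y Z S T \<Phi>. closed_splitting V Y Z \<and> x0 \<in> S \<and> C1_diffeo V V S T \<Phi> \<and>
      \<Phi> ` ({x \<in> U. \<Lambda> x = F x} \<inter> S) = Y \<inter> T"
    using S(1) diffeo by blast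
qed

section \<open>The space of square integrable functions on a set\<close>

lemma vanishes_outside_zero: "vanishes_outside \<Omega> 0"
  by transfer simp

lemma vanishes_outside_add:
  "vanishes_outside \<Omega> u \<Longrightarrow> vanishes_outside \<Omega> v \<Longrightarrow> vanishes_outside \<Omega> (u + v)"
  by transfer (auto elim: AE_mp)

lemma vanishes_outside_scaleR: "vanishes_outside \<Omega> u \<Longrightarrow> vanishes_outside \<Omega> (c *\<^sub>R u)"
  by transfer (auto elim: AE_mp)

lemma subspace_L2_on: "subspace (L2_on \<Omega>)"
  by (rule subspaceI)
    (auto simp: L2_on_def vanishes_outside_zero vanishes_outside_add vanishes_outside_scaleR)

lemma inner_disjoint_supports:
  "vanishes_outside \<Omega> u \<Longrightarrow> vanishes_outside (- \<Omega>) v \<Longrightarrow> u \<bullet> v = 0"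
  by transfer (auto intro!: integral_eq_zero_AE elim: AE_mp)

text \<open>
  The test vector is the part of \<open>u\<close> outside \<open>\<Omega>\<close>, whose inner product with \<open>u\<close> is its squared norm. So
  \<open>L\<^sup>2(\<Omega>)\<close> is the orthogonal complement of the classes supported off \<open>\<Omega>\<close>, and hence closed.
\<close>

lemma vanishes_outside_by_test:
  assumes "\<Omega> \<in> sets lebesgue"
  shows "\<exists>v. vanishes_outside (- \<Omega>) v \<and> (u \<bullet> v = 0 \<longrightarrow> vanishes_outside \<Omega> u)"
  using assms
proof transfer
  fix \<Omega> :: "'a set" and f :: "'a \<Rightarrow> real"
  assume f: "L2_rel f f" and \<Omega>: "\<Omega> \<in> sets lebesgue"
  define g where "g x = indicat_real (- \<Omega>) x * f x" for x
  have f': "f \<in> borel_measurable lebesgue" "integrable lebesgue (\<lambda>x. (f x)\<^sup>2)"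
    using f by (auto simp: L2_rel_def square_integrable_def)
  have ind: "indicat_real (- \<Omega>) \<in> borel_measurable lebesgue"
    using sets.compl_sets[OF \<Omega>] by (intro borel_measurable_indicator) (simp add: Compl_eq_Diff_UNIV)
  have meas: "g \<in> borel_measurable lebesgue"
    unfolding g_def by (rule borel_measurable_times[OF ind f'(1)])
  have "integrable lebesgue (\<lambda>x. (g x)\<^sup>2)"
  proof (rule Bochner_Integration.integrable_bound[OF f'(2)])
    show "(\<lambda>x. (g x)\<^sup>2) \<in> borel_measurable lebesgue" using meas by (rule borel_measurable_power)
    show "AE x in lebesgue. norm ((g x)\<^sup>2) \<le> norm ((f x)\<^sup>2)"
      by (intro AE_I2) (simp add: g_def indicator_def)
  qed
  then have g: "L2_rel g g" using meas by (simp add: L2_rel_def square_integrable_def)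
  have "AE x in lebesgue. x \<notin> \<Omega> \<longrightarrow> f x = 0" if 0: "(\<integral>x. f x * g x \<partial>lebesgue) = 0"
  proof -
    have "integrable lebesgue (\<lambda>x. f x * g x)"
      using f g by (intro square_integrable_mult) (auto simp: L2_rel_def)
    then have "AE x in lebesgue. f x * g x = 0"
      using 0 by (subst (asm) integral_nonneg_eq_0_iff_AE) (auto simp: g_def indicator_def)
    then show ?thesis by eventually_elim (auto simp: g_def)
  qed
  then show "\<exists>g\<in>{g. L2_rel g g}. (AE x in lebesgue. x \<notin> - \<Omega> \<longrightarrow> g x = 0) \<and>
      ((\<integral>x. f x * g x \<partial>lebesgue) = 0 \<longrightarrow> (AE x in lebesgue. x \<notin> \<Omega> \<longrightarrow> f x = 0))"
    using g by (intro bexI[of _ g]) (auto simp: g_def)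
qed

lemma closed_L2_on:
  assumes "\<Omega> \<in> sets lebesgue"
  shows "closed (L2_on \<Omega>)"
proof -
  have "L2_on \<Omega> = (\<Inter>v\<in>{v. vanishes_outside (- \<Omega>) v}. {u. u \<bullet> v = 0})"
    using vanishes_outside_by_test[OF assms] inner_disjoint_supports[of \<Omega>]
    unfolding L2_on_def by blast
  then show ?thesis
    by (auto intro!: closed_INT closed_Collect_eq continuous_intros)
qed

section \<open>Generators\<close>

text \<open>
  The difference quotients \<open>Q x\<close> are linear in \<open>x\<close> for each \<open>t > 0\<close>, and limits are unique; so the domain
  is linear and the generator inherits linearity from the semigroup.
\<close>

lemma generator_linear:
  assumes H: "subspace H" and T: "C0_semigroup H T" and G: "generator H T D G"
  shows "subspace D" and "D \<subseteq> H"
    and "\<And>x. x \<in> D \<Longrightarrow> G x \<in> H"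
    and "\<And>x y. x \<in> D \<Longrightarrow> y \<in> D \<Longrightarrow> G (x + y) = G x + G y"
    and "\<And>c x. x \<in> D \<Longrightarrow> G (c *\<^sub>R x) = c *\<^sub>R G x"
proof -
  define Q where "Q x t = (1 / t) *\<^sub>R (T t x - x)" for x t
  have D: "D = {x \<in> H. \<exists>y\<in>H. (Q x \<longlongrightarrow> y) (at_right 0)}"
    and lim: "\<And>x. x \<in> D \<Longrightarrow> (Q x \<longlongrightarrow> G x) (at_right 0)"
    using G by (auto simp: generator_def Q_def[abs_def])
  have Tl: "T t \<in> Lc (sub_nspace H) (sub_nspace H)" if "t \<ge> 0" for t
    using T that by (simp add: C0_semigroup_def)
  have DI: "x \<in> D \<and> G x = y" if "x \<in> H" "y \<in> H" "(Q x \<longlongrightarrow> y) (at_right 0)" for x y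
  proof -
    have "x \<in> D" using that by (auto simp: D)
    then show ?thesis using tendsto_unique[OF _ lim that(3)] by simp
  qed
  show DH: "D \<subseteq> H" by (auto simp: D)
  show GH: "G x \<in> H" if "x \<in> D" for x
    using that DI unfolding D by blast
  have add: "x + y \<in> D \<and> G (x + y) = G x + G y" if xy: "x \<in> D" "y \<in> D" for x y
  proof (rule DI)
    show "x + y \<in> H" "G x + G y \<in> H" using xy DH GH subspace_add[OF H] by blast+
    have "\<forall>\<^sub>F t in at_right 0. Q x t + Q y t = Q (x + y) t"
      using eventually_at_right_less[of "0::real"]
    proof eventually_elim
      case (elim t)
      have "T t (x + y) = T t x + T t y" using Lc_add[OF Tl, of t x y] elim xy DH by auto
      then show ?case by (simp add: Q_def algebra_simps)
    qed
    with tendsto_add[OF lim[OF xy(1)] lim[OF xy(2)]]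
    show "(Q (x + y) \<longlongrightarrow> G x + G y) (at_right 0)" by (rule Lim_transform_eventually)
  qed
  have scale: "c *\<^sub>R x \<in> D \<and> G (c *\<^sub>R x) = c *\<^sub>R G x" if x: "x \<in> D" for c x
  proof (rule DI)
    show "c *\<^sub>R x \<in> H" "c *\<^sub>R G x \<in> H" using x DH GH subspace_scale[OF H] by blast+
    have "\<forall>\<^sub>F t in at_right 0. c *\<^sub>R Q x t = Q (c *\<^sub>R x) t"
      using eventually_at_right_less[of "0::real"]
    proof eventually_elim
      case (elim t)
      have "T t (c *\<^sub>R x) = c *\<^sub>R T t x" using Lc_scaleR[OF Tl, of t x c] elim x DH by auto
      then show ?case by (simp add: Q_def algebra_simps)
    qed
    with tendsto_scaleR[OF tendsto_const lim[OF x]]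
    show "(Q (c *\<^sub>R x) \<longlongrightarrow> c *\<^sub>R G x) (at_right 0)" by (rule Lim_transform_eventually)
  qed
  have "0 \<in> D"
  proof -
    have "\<forall>\<^sub>F t in at_right 0. 0 = Q 0 t"
      using eventually_at_right_less[of "0::real"]
    proof eventually_elim
      case (elim t)
      have "T t 0 = 0" using Lc_zero[OF normed_carrier_sub_nspace[OF H] Tl] elim by simp
      then show ?case by (simp add: Q_def)
    qed
    with tendsto_const have "(Q 0 \<longlongrightarrow> 0) (at_right 0)" by (rule Lim_transform_eventually)
    then show ?thesis using DI[of 0 0] subspace_0[OF H] by blast
  qed
  then show "subspace D" using add scale by (auto intro: subspaceI)
  show "G (x + y) = G x + G y" if "x \<in> D" "y \<in> D" for x y using add[OF that] by blast
  show "G (c *\<^sub>R x) = c *\<^sub>R G x" if "x \<in> D" for c x using scale[OF that] by blast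
qed

section \<open>Norms and derivatives of paths\<close>

lemma sup_norm_upper:
  assumes "continuous_on {-h..0} \<phi>" "\<theta> \<in> {-h..0}"
  shows "norm (\<phi> \<theta>) \<le> sup_norm h \<phi>"
  unfolding sup_norm_def
proof (rule cSUP_upper[OF assms(2)])
  have "compact ((\<lambda>\<theta>. norm (\<phi> \<theta>)) ` {-h..0})"
    using assms(1) by (intro compact_continuous_image continuous_intros) auto
  then show "bdd_above ((\<lambda>\<theta>. norm (\<phi> \<theta>)) ` {-h..0})"
    by (intro bounded_imp_bdd_above compact_imp_bounded)
qed

lemma sup_norm_least:
  assumes "h \<ge> 0" "\<And>\<theta>. \<theta> \<in> {-h..0} \<Longrightarrow> norm (\<phi> \<theta>) \<le> K"
  shows "sup_norm h \<phi> \<le> K"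
  unfolding sup_norm_def using assms by (intro cSUP_least) auto

lemma sup_norm_nonneg:
  assumes "h \<ge> 0" "continuous_on {-h..0} \<phi>"
  shows "0 \<le> sup_norm h \<phi>"
  using order.trans[OF norm_ge_zero sup_norm_upper[OF assms(2), of 0]] assms(1) by simp

lemma sup_norm_triangle:
  assumes "h \<ge> 0" "continuous_on {-h..0} \<phi>" "continuous_on {-h..0} \<psi>"
    and "\<And>\<theta>. \<theta> \<in> {-h..0} \<Longrightarrow> \<omega> \<theta> = \<phi> \<theta> + \<psi> \<theta>"
  shows "sup_norm h \<omega> \<le> sup_norm h \<phi> + sup_norm h \<psi>"
proof (rule sup_norm_least[OF assms(1)])
  fix \<theta> assume \<theta>: "\<theta> \<in> {-h..0}"
  show "norm (\<omega> \<theta>) \<le> sup_norm h \<phi> + sup_norm h \<psi>"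
    using norm_triangle_ineq[of "\<phi> \<theta>" "\<psi> \<theta>"] sup_norm_upper[OF assms(2) \<theta>] sup_norm_upper[OF assms(3) \<theta>]
      assms(4)[OF \<theta>] by simp
qed

lemma sup_norm_scaleR:
  assumes "h \<ge> 0" "continuous_on {-h..0} \<phi>" and \<omega>: "\<And>\<theta>. \<theta> \<in> {-h..0} \<Longrightarrow> \<omega> \<theta> = c *\<^sub>R \<phi> \<theta>"
  shows "sup_norm h \<omega> = \<bar>c\<bar> * sup_norm h \<phi>"
proof (rule antisym)
  show "sup_norm h \<omega> \<le> \<bar>c\<bar> * sup_norm h \<phi>"
    using sup_norm_upper[OF assms(2)] \<omega> by (intro sup_norm_least[OF assms(1)]) (auto intro: mult_left_mono)
  have "continuous_on {-h..0} (\<lambda>\<theta>. c *\<^sub>R \<phi> \<theta>)" using assms(2) by (intro continuous_intros)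
  then have "continuous_on {-h..0} \<omega>" by (rule continuous_on_eq) (simp add: \<omega>)
  note up = sup_norm_upper[OF this]
  show "\<bar>c\<bar> * sup_norm h \<phi> \<le> sup_norm h \<omega>"
  proof (cases "c = 0")
    case True
    then show ?thesis using up[of 0] \<omega>[of 0] assms(1) by simp
  next
    case False
    have "norm (\<phi> \<theta>) \<le> sup_norm h \<omega> / \<bar>c\<bar>" if "\<theta> \<in> {-h..0}" for \<theta>
      using up[OF that] \<omega>[OF that] False by (simp add: field_simps)
    then have "sup_norm h \<phi> \<le> sup_norm h \<omega> / \<bar>c\<bar>" by (rule sup_norm_least[OF assms(1)])
    then show ?thesis using False by (simp add: field_simps)
  qed
qed

text \<open>
  For \<open>h = 0\<close> the interval is a point, and every vector would be a derivative there.
\<close>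

lemma path_deriv_eqI:
  assumes "h > 0" "\<theta> \<in> {-h..0}" "(\<phi> has_vector_derivative d) (at \<theta> within {-h..0})"
  shows "path_deriv h \<phi> \<theta> = d"
  unfolding path_deriv_def using assms
  by (intro vector_derivative_within) (auto simp: trivial_limit_within islimpt_Icc)

lemma vector_derivative_in_closed_subspace:
  assumes H: "subspace H" "closed H" and "h > 0" and \<theta>: "\<theta> \<in> {-h..0::real}"
    and \<phi>: "\<And>t. t \<in> {-h..0} \<Longrightarrow> \<phi> t \<in> H"
    and der: "(\<phi> has_vector_derivative d) (at \<theta> within {-h..0})"
  shows "d \<in> H"
proof -
  have "\<exists>y\<in>H. dist y d < e" if "e > 0" for e
  proof -
    obtain k where k: "k > 0" and diff: "\<And>t. t \<in> {-h..0} \<Longrightarrow> norm (t - \<theta>) < k \<Longrightarrow>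
        norm (\<phi> t - \<phi> \<theta> - (t - \<theta>) *\<^sub>R d) \<le> e / 2 * norm (t - \<theta>)"
      using der half_gt_zero[OF \<open>e > 0\<close>] unfolding has_vector_derivative_def has_derivative_within_alt by meson
    have "\<theta> islimpt {-h..0}" using \<open>h > 0\<close> \<theta> by (simp add: islimpt_Icc)
    then obtain t where t: "t \<in> {-h..0}" "t \<noteq> \<theta>" "norm (t - \<theta>) < k"
      using k unfolding islimpt_approachable dist_norm by blast
    define y where "y = (1 / (t - \<theta>)) *\<^sub>R (\<phi> t - \<phi> \<theta>)"
    have "y \<in> H" unfolding y_def
      by (intro subspace_scale[OF H(1)] subspace_diff[OF H(1)] \<phi> t \<theta>)
    have "y - d = (1 / (t - \<theta>)) *\<^sub>R (\<phi> t - \<phi> \<theta> - (t - \<theta>) *\<^sub>R d)"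
      using t(2) by (simp add: y_def scaleR_diff_right)
    then have "norm (y - d) = norm (\<phi> t - \<phi> \<theta> - (t - \<theta>) *\<^sub>R d) / \<bar>t - \<theta>\<bar>" by simp
    also have "\<dots> \<le> e / 2" using diff[OF t(1,3)] t(2) by (simp add: divide_le_eq)
    finally show ?thesis using \<open>y \<in> H\<close> \<open>e > 0\<close> by (intro bexI[of _ y]) (auto simp: dist_norm)
  qed
  then show ?thesis using closed_approachable[OF H(2)] by blast
qed

section \<open>The space of continuously differentiable paths\<close>

lemma C_spaceD:
  assumes "\<phi> \<in> carr (C_space h H)"
  shows "continuous_on {-h..0} \<phi>" and "\<And>\<theta>. \<theta> \<in> {-h..0} \<Longrightarrow> \<phi> \<theta> \<in> H"
    and "\<And>\<theta>. \<theta> \<notin> {-h..0} \<Longrightarrow> \<phi> \<theta> = 0"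
  using assms by (auto simp: C_space_def)

lemma X_spaceD:
  assumes "\<phi> \<in> carr (X_space h H D A)"
  shows "\<phi> \<in> carr (C_space h H)" and "continuous_on {-h..0} (path_deriv h \<phi>)" and "\<phi> 0 \<in> D"
    and "\<And>\<theta>. \<theta> \<in> {-h..0} \<Longrightarrow>
      (\<phi> has_vector_derivative path_deriv h \<phi> \<theta>) (at \<theta> within {-h..0})"
  using assms unfolding path_deriv_def by (auto simp: X_space_def path_deriv_def[abs_def] vector_derivative_works)

text \<open>
  The derivative is supplied as a function \<open>d\<close>, because \<open>path_deriv\<close> has no useful value outside
  \<open>[-h, 0]\<close> and need only agree with \<open>d\<close> on the interval.
\<close>

lemma X_spaceI:
  assumes "h > 0" "\<phi> \<in> carr (C_space h H)" "\<phi> 0 \<in> D" "continuous_on {-h..0} d"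
    and der: "\<And>\<theta>. \<theta> \<in> {-h..0} \<Longrightarrow> (\<phi> has_vector_derivative d \<theta>) (at \<theta> within {-h..0})"
  shows "\<phi> \<in> carr (X_space h H D A)"
proof -
  have "path_deriv h \<phi> \<theta> = d \<theta>" if "\<theta> \<in> {-h..0}" for \<theta>
    by (rule path_deriv_eqI[OF assms(1) that der[OF that]])
  then have "continuous_on {-h..0} (path_deriv h \<phi>)"
    by (intro continuous_on_eq[OF assms(4)]) simp
  moreover have "\<phi> differentiable (at \<theta> within {-h..0})" if "\<theta> \<in> {-h..0}" for \<theta>
    using der[OF that] by (rule differentiableI_vector)
  ultimately show ?thesis using assms by (simp add: X_space_def)
qed

lemma path_deriv_add:
  assumes "h > 0" "\<phi> \<in> carr (X_space h H D A)" "\<psi> \<in> carr (X_space h H D A)" "\<theta> \<in> {-h..0}"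
  shows "path_deriv h (\<phi> + \<psi>) \<theta> = path_deriv h \<phi> \<theta> + path_deriv h \<psi> \<theta>"
  using has_vector_derivative_add[OF X_spaceD(4)[OF assms(2,4)] X_spaceD(4)[OF assms(3,4)]]
  by (intro path_deriv_eqI[OF assms(1,4)]) (simp add: plus_fun_def)

lemma path_deriv_scaleR:
  assumes "h > 0" "\<phi> \<in> carr (X_space h H D A)" "\<theta> \<in> {-h..0}"
  shows "path_deriv h (c *\<^sub>R \<phi>) \<theta> = c *\<^sub>R path_deriv h \<phi> \<theta>"
  using has_vector_derivative_scaleR[OF DERIV_const X_spaceD(4)[OF assms(2,3)], of c]
  by (intro path_deriv_eqI[OF assms(1,3)]) (simp add: scaleR_fun_def)

lemma nrm_X_space:
  "nrm (X_space h H D A) \<phi> = sup_norm h \<phi> + sup_norm h (path_deriv h \<phi>) + norm (A (\<phi> 0))"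
  by (simp add: X_space_def)

lemma normed_carrier_X_space:
  assumes h: "h > 0" and H: "subspace H" and D: "subspace D"
    and A_add: "\<And>x y. x \<in> D \<Longrightarrow> y \<in> D \<Longrightarrow> A (x + y) = A x + A y"
    and A_scale: "\<And>c x. x \<in> D \<Longrightarrow> A (c *\<^sub>R x) = c *\<^sub>R A x"
  shows "normed_carrier (X_space h H D A)"
proof
  let ?X = "X_space h H D A"
  have h0: "h \<ge> 0" using h by simp
  have C_add: "\<phi> + \<psi> \<in> carr (C_space h H)" if "\<phi> \<in> carr (C_space h H)" "\<psi> \<in> carr (C_space h H)" for \<phi> \<psi>
    using that H by (auto simp: C_space_def plus_fun_def intro!: continuous_intros subspace_add)
  have C_scale: "c *\<^sub>R \<phi> \<in> carr (C_space h H)" if "\<phi> \<in> carr (C_space h H)" for c \<phi>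
    using that H by (auto simp: C_space_def scaleR_fun_def intro!: continuous_intros subspace_scale)
  show "subspace (carr ?X)"
  proof (rule subspaceI)
    show "0 \<in> carr ?X"
    proof (rule X_spaceI[OF h, where d = "\<lambda>_. 0"])
      show "0 \<in> carr (C_space h H)" using subspace_0[OF H] by (auto simp: C_space_def zero_fun_def)
    qed (auto simp: zero_fun_def subspace_0[OF D])
    fix \<phi> \<psi> and c :: real assume \<phi>: "\<phi> \<in> carr ?X"
    show "c *\<^sub>R \<phi> \<in> carr ?X"
    proof (rule X_spaceI[OF h C_scale, where d = "\<lambda>\<theta>. c *\<^sub>R path_deriv h \<phi> \<theta>"])
      show "(c *\<^sub>R \<phi> has_vector_derivative c *\<^sub>R path_deriv h \<phi> \<theta>) (at \<theta> within {-h..0})"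
        if "\<theta> \<in> {-h..0}" for \<theta>
        using has_vector_derivative_scaleR[OF DERIV_const X_spaceD(4)[OF \<phi> that], of c]
        by (simp add: scaleR_fun_def)
    qed (use X_spaceD[OF \<phi>] subspace_scale[OF D] in \<open>auto simp: scaleR_fun_def intro!: continuous_intros\<close>)
    assume \<psi>: "\<psi> \<in> carr ?X"
    show "\<phi> + \<psi> \<in> carr ?X"
    proof (rule X_spaceI[OF h C_add, where d = "\<lambda>\<theta>. path_deriv h \<phi> \<theta> + path_deriv h \<psi> \<theta>"])
      show "(\<phi> + \<psi> has_vector_derivative path_deriv h \<phi> \<theta> + path_deriv h \<psi> \<theta>) (at \<theta> within {-h..0})"
        if "\<theta> \<in> {-h..0}" for \<theta>
        using has_vector_derivative_add[OF X_spaceD(4)[OF \<phi> that] X_spaceD(4)[OF \<psi> that]]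
        by (simp add: plus_fun_def)
    qed (use X_spaceD[OF \<phi>] X_spaceD[OF \<psi>] subspace_add[OF D] in \<open>auto simp: plus_fun_def intro!: continuous_intros\<close>)
  qed
  fix \<phi> assume \<phi>: "\<phi> \<in> carr ?X"
  note c = C_spaceD(1)[OF X_spaceD(1)[OF \<phi>]] X_spaceD(2)[OF \<phi>]
  show "0 \<le> nrm ?X \<phi>"
    using sup_norm_nonneg[OF h0 c(1)] sup_norm_nonneg[OF h0 c(2)] by (simp add: nrm_X_space)
  show "\<phi> = 0" if 0: "nrm ?X \<phi> = 0"
  proof
    fix \<theta>
    have "sup_norm h \<phi> \<le> 0"
      using 0 sup_norm_nonneg[OF h0 c(2)] norm_ge_zero[of "A (\<phi> 0)"] unfolding nrm_X_space by linarith
    then have "norm (\<phi> \<theta>) \<le> 0" if "\<theta> \<in> {-h..0}"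
      using sup_norm_upper[OF c(1) that] by linarith
    then show "\<phi> \<theta> = 0 \<theta>"
      using C_spaceD(3)[OF X_spaceD(1)[OF \<phi>], of \<theta>] by (cases "\<theta> \<in> {-h..0}") auto
  qed
  show "nrm ?X (a *\<^sub>R \<phi>) = \<bar>a\<bar> * nrm ?X \<phi>" for a
  proof -
    have "sup_norm h (a *\<^sub>R \<phi>) = \<bar>a\<bar> * sup_norm h \<phi>"
      by (rule sup_norm_scaleR[OF h0 c(1)]) (simp add: scaleR_fun_def)
    moreover have "sup_norm h (path_deriv h (a *\<^sub>R \<phi>)) = \<bar>a\<bar> * sup_norm h (path_deriv h \<phi>)"
      by (rule sup_norm_scaleR[OF h0 c(2)]) (rule path_deriv_scaleR[OF h \<phi>])
    ultimately show ?thesis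
      using A_scale[OF X_spaceD(3)[OF \<phi>], of a] by (simp add: nrm_X_space scaleR_fun_def distrib_left)
  qed
  fix \<psi> assume \<psi>: "\<psi> \<in> carr ?X"
  note c' = C_spaceD(1)[OF X_spaceD(1)[OF \<psi>]] X_spaceD(2)[OF \<psi>]
  have "sup_norm h (\<phi> + \<psi>) \<le> sup_norm h \<phi> + sup_norm h \<psi>"
    by (rule sup_norm_triangle[OF h0 c(1) c'(1)]) simp
  moreover have "sup_norm h (path_deriv h (\<phi> + \<psi>)) \<le> sup_norm h (path_deriv h \<phi>) + sup_norm h (path_deriv h \<psi>)"
    by (rule sup_norm_triangle[OF h0 c(2) c'(2)]) (rule path_deriv_add[OF h \<phi> \<psi>])
  ultimately show "nrm ?X (\<phi> + \<psi>) \<le> nrm ?X \<phi> + nrm ?X \<psi>"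
    using A_add[OF X_spaceD(3)[OF \<phi>] X_spaceD(3)[OF \<psi>]] norm_triangle_ineq[of "A (\<phi> 0)" "A (\<psi> 0)"]
    by (simp add: nrm_X_space)
qed

lemma velocity_plus_operator_in_Lc:
  assumes h: "h > 0" and H: "subspace H" "closed H" and A_maps: "\<And>x. x \<in> D \<Longrightarrow> A x \<in> H"
    and A_add: "\<And>x y. x \<in> D \<Longrightarrow> y \<in> D \<Longrightarrow> A (x + y) = A x + A y"
    and A_scale: "\<And>c x. x \<in> D \<Longrightarrow> A (c *\<^sub>R x) = c *\<^sub>R A x"
  shows "(\<lambda>\<phi>. path_deriv h \<phi> 0 + A (\<phi> 0)) \<in> Lc (X_space h H D A) (sub_nspace H)"
proof (rule LcI[where K = 1])
  let ?X = "X_space h H D A"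
  have 0: "0 \<in> {-h..0}" using h by simp
  fix \<phi> assume \<phi>: "\<phi> \<in> carr ?X"
  have "path_deriv h \<phi> 0 \<in> H"
    by (rule vector_derivative_in_closed_subspace[OF H h 0 _ X_spaceD(4)[OF \<phi> 0]])
      (rule C_spaceD(2)[OF X_spaceD(1)[OF \<phi>]])
  then show "path_deriv h \<phi> 0 + A (\<phi> 0) \<in> carr (sub_nspace H)"
    using A_maps[OF X_spaceD(3)[OF \<phi>]] subspace_add[OF H(1)] by simp
  show "path_deriv h (c *\<^sub>R \<phi>) 0 + A ((c *\<^sub>R \<phi>) 0) = c *\<^sub>R (path_deriv h \<phi> 0 + A (\<phi> 0))" for c
    using path_deriv_scaleR[OF h \<phi> 0] A_scale[OF X_spaceD(3)[OF \<phi>]]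
    by (simp add: scaleR_fun_def scaleR_add_right)
  have "norm (path_deriv h \<phi> 0) \<le> sup_norm h (path_deriv h \<phi>)"
    by (rule sup_norm_upper[OF X_spaceD(2)[OF \<phi>] 0])
  moreover have "0 \<le> sup_norm h \<phi>"
    using sup_norm_nonneg[OF _ C_spaceD(1)[OF X_spaceD(1)[OF \<phi>]]] h by simp
  ultimately show "nrm (sub_nspace H) (path_deriv h \<phi> 0 + A (\<phi> 0)) \<le> 1 * nrm ?X \<phi>"
    using norm_triangle_ineq[of "path_deriv h \<phi> 0" "A (\<phi> 0)"] by (simp add: nrm_X_space)
  fix \<psi> assume \<psi>: "\<psi> \<in> carr ?X"
  show "path_deriv h (\<phi> + \<psi>) 0 + A ((\<phi> + \<psi>) 0) =
      path_deriv h \<phi> 0 + A (\<phi> 0) + (path_deriv h \<psi> 0 + A (\<psi> 0))"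
    using path_deriv_add[OF h \<phi> \<psi> 0] A_add[OF X_spaceD(3)[OF \<phi>] X_spaceD(3)[OF \<psi>]] by simp
qed

section \<open>Short waves as right inverses\<close>

text \<open>
  A path with slope \<open>q\<close> at \<open>0\<close> whose size is of order \<open>\<epsilon>\<close> while its slopes have norm at most \<open>\<parallel>q\<parallel>\<close>. It
  separates the norms of \<open>X\<close> and \<open>X\<^sub>0\<close>, and it vanishes at \<open>0\<close>, where \<open>A\<close> is evaluated.
\<close>

definition ripple :: "real \<Rightarrow> real \<Rightarrow> 'v::real_normed_vector \<Rightarrow> real \<Rightarrow> 'v" where
  "ripple h \<epsilon> q \<theta> = (if \<theta> \<in> {-h..0} then (\<epsilon> * sin (\<theta> / \<epsilon>)) *\<^sub>R q else 0)"

lemma ripple_has_derivative: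
  assumes "\<epsilon> > 0" "\<theta> \<in> {-h..0}"
  shows "(ripple h \<epsilon> q has_vector_derivative cos (\<theta> / \<epsilon>) *\<^sub>R q) (at \<theta> within {-h..0})"
proof (rule has_vector_derivative_transform[OF assms(2)])
  have "((\<lambda>\<theta>. \<epsilon> * sin (\<theta> / \<epsilon>)) has_real_derivative cos (\<theta> / \<epsilon>)) (at \<theta> within {-h..0})"
    using assms(1) by (auto intro!: derivative_eq_intros)
  from has_vector_derivative_scaleR[OF this has_vector_derivative_const[of q]]
  show "((\<lambda>\<theta>. (\<epsilon> * sin (\<theta> / \<epsilon>)) *\<^sub>R q) has_vector_derivative cos (\<theta> / \<epsilon>) *\<^sub>R q) (at \<theta> within {-h..0})"
    by simp
qed (simp add: ripple_def)

lemma ripple_in_X_space: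
  assumes h: "h > 0" and \<epsilon>: "\<epsilon> > 0" and H: "subspace H" and D: "0 \<in> D" and q: "q \<in> H"
  shows "ripple h \<epsilon> q \<in> carr (X_space h H D A)"
proof (rule X_spaceI[OF h])
  have "continuous_on {-h..0} (\<lambda>\<theta>. (\<epsilon> * sin (\<theta> / \<epsilon>)) *\<^sub>R q)"
    using \<epsilon> by (intro continuous_intros) auto
  then have "continuous_on {-h..0} (ripple h \<epsilon> q)"
    by (rule continuous_on_eq) (simp add: ripple_def)
  then show "ripple h \<epsilon> q \<in> carr (C_space h H)"
    using subspace_scale[OF H q] by (auto simp: C_space_def ripple_def)
  show "ripple h \<epsilon> q 0 \<in> D" using D by (simp add: ripple_def)
  show "continuous_on {-h..0} (\<lambda>\<theta>. cos (\<theta> / \<epsilon>) *\<^sub>R q)"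
    using \<epsilon> by (intro continuous_intros) auto
qed (rule ripple_has_derivative[OF \<epsilon>])

lemma path_deriv_ripple:
  assumes "h > 0" "\<epsilon> > 0" "\<theta> \<in> {-h..0}"
  shows "path_deriv h (ripple h \<epsilon> q) \<theta> = cos (\<theta> / \<epsilon>) *\<^sub>R q"
  by (rule path_deriv_eqI[OF assms(1,3) ripple_has_derivative[OF assms(2,3)]])

lemma sup_norm_ripple:
  assumes "h > 0" "\<epsilon> > 0"
  shows "sup_norm h (ripple h \<epsilon> q) \<le> \<epsilon> * norm q"
  using assms by (intro sup_norm_least) (auto simp: ripple_def abs_mult mult_right_mono intro: mult_left_le)

lemma ripple_in_Lc:
  assumes h: "h > 0" and \<epsilon>: "\<epsilon> > 0" and H: "subspace H" and D: "0 \<in> D" and A0: "A 0 = 0"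
  shows "ripple h \<epsilon> \<in> Lc (sub_nspace H) (X_space h H D A)"
proof (rule LcI[where K = "\<epsilon> + 1"])
  fix q assume "q \<in> carr (sub_nspace H)"
  then have q: "q \<in> H" by simp
  show "ripple h \<epsilon> q \<in> carr (X_space h H D A)" by (rule ripple_in_X_space[OF h \<epsilon> H D q])
  show "ripple h \<epsilon> (p + q) = ripple h \<epsilon> p + ripple h \<epsilon> q" for p
    by (auto simp: ripple_def fun_eq_iff scaleR_add_right)
  show "ripple h \<epsilon> (c *\<^sub>R q) = c *\<^sub>R ripple h \<epsilon> q" for c
    by (auto simp: ripple_def fun_eq_iff scaleR_fun_def)
  have "sup_norm h (path_deriv h (ripple h \<epsilon> q)) \<le> norm q"
    using h by (intro sup_norm_least) (auto simp: path_deriv_ripple[OF h \<epsilon>] intro: mult_left_le_one_le)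
  then show "nrm (X_space h H D A) (ripple h \<epsilon> q) \<le> (\<epsilon> + 1) * nrm (sub_nspace H) q"
    using sup_norm_ripple[OF h \<epsilon>, of q] A0 by (simp add: nrm_X_space ripple_def distrib_right)
qed

section \<open>The solution manifold\<close>

theorem lemma1:
  fixes \<Omega> :: "(real ^ 'n) set" and h :: real
    and D :: "(real ^ 'n) L2 set" and A B :: "(real ^ 'n) L2 \<Rightarrow> (real ^ 'n) L2"
    and r :: "(real \<Rightarrow> (real ^ 'n) L2) \<Rightarrow> real"
    and U :: "(real \<Rightarrow> (real ^ 'n) L2) set"
    and DF :: "(real \<Rightarrow> (real ^ 'n) L2) \<Rightarrow> (real \<Rightarrow> (real ^ 'n) L2) \<Rightarrow> (real ^ 'n) L2"
  defines "H \<equiv> L2_on \<Omega>"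
  defines "C \<equiv> C_space h H" and "X \<equiv> X_space h H D A" and "X\<^sub>0 \<equiv> X0_space h H D A"
  defines "F \<equiv> delay_term B r"
  assumes domain: "open \<Omega>" "connected \<Omega>" "\<Omega> \<noteq> {}"
    and h: "h > 0"
    and A: "generates_compact_analytic_semigroup H D (\<lambda>x. - A x)"
    and B_maps: "\<forall>x\<in>H. B x \<in> H"
    and B_bounded: "\<forall>S. S \<subseteq> H \<and> bounded S \<longrightarrow> bounded (B ` S)"
    and B_lipschitz: "\<exists>K. K-lipschitz_on H B"
    and r_maps: "\<forall>\<phi>\<in>carr C. r \<phi> \<in> {0..h}"
    and r_lipschitz: "\<exists>K. \<forall>\<phi>\<in>carr C. \<forall>\<psi>\<in>carr C. \<bar>r \<phi> - r \<psi>\<bar> \<le> K * nrm C (\<phi> - \<psi>)"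
    and U: "nopen X U"
    and F_C1: "C1_map X (sub_nspace H) U F DF"
    and DF_extends: "\<forall>\<phi>\<in>U. \<exists>E \<in> Lc X\<^sub>0 (sub_nspace H). \<forall>v\<in>carr X. E v = DF \<phi> v"
    and nonempty: "solution_manifold h A F U \<noteq> {}"
  shows "C1_submanifold X (solution_manifold h A F U)"
proof -
  have H: "subspace H" "closed H"
    using domain(1) unfolding H_def by (auto intro: subspace_L2_on closed_L2_on)
  obtain T where T: "C0_semigroup H T" "generator H T D (\<lambda>x. - A x)"
    using A unfolding generates_compact_analytic_semigroup_def by blast
  note gen = generator_linear[OF H(1) T]
  have D: "subspace D" by (rule gen(1))
  have A_maps: "A x \<in> H" if "x \<in> D" for x
    using subspace_neg[OF H(1) gen(3)[OF that]] by simp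
  have A_add: "A (x + y) = A x + A y" if "x \<in> D" "y \<in> D" for x y
    using gen(4)[OF that] by (metis add.inverse_inverse minus_add_distrib)
  have A_scale: "A (c *\<^sub>R x) = c *\<^sub>R A x" if "x \<in> D" for c x
    using gen(5)[OF that, of c] by simp
  have D0: "0 \<in> D" by (rule subspace_0[OF D])
  have A0: "A 0 = 0" using A_scale[OF D0, of 0] by simp
  let ?\<Lambda> = "\<lambda>\<phi>. path_deriv h \<phi> 0 + A (\<phi> 0)"
  have "C1_submanifold X {\<phi> \<in> U. ?\<Lambda> \<phi> = F \<phi>}"
  proof (rule level_set_C1_submanifold[OF _ H U F_C1])
    show "normed_carrier X"
      unfolding X_def by (rule normed_carrier_X_space[OF h H(1) D A_add A_scale])
    show "?\<Lambda> \<in> Lc X (sub_nspace H)"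
      unfolding X_def by (rule velocity_plus_operator_in_Lc[OF h H A_maps A_add A_scale])
    fix \<phi> assume \<phi>: "\<phi> \<in> U"
    then obtain E where E: "E \<in> Lc X\<^sub>0 (sub_nspace H)" "\<And>v. v \<in> carr X \<Longrightarrow> E v = DF \<phi> v"
      using DF_extends by blast
    obtain K where K: "\<And>v. v \<in> carr X\<^sub>0 \<Longrightarrow> norm (E v) \<le> K * nrm X\<^sub>0 v"
      using E(1) unfolding Lc_def nrm_sub_nspace by blast
    \<comment> \<open>on \<open>X\<^sub>0\<close> the extended derivative has the bound \<open>K\<close>, and \<open>K * \<epsilon> \<le> 1/2\<close>\<close>
    define \<epsilon> where "\<epsilon> = 1 / (2 * (\<bar>K\<bar> + 1))"
    have \<epsilon>: "\<epsilon> > 0" by (simp add: \<epsilon>_def add_nonneg_pos)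
    have K\<epsilon>: "\<bar>K\<bar> * \<epsilon> \<le> 1 / 2" by (simp add: \<epsilon>_def divide_simps)
    have "norm (DF \<phi> (ripple h \<epsilon> q)) \<le> 1 / 2 * norm q" if q: "q \<in> H" for q
    proof -
      have X: "ripple h \<epsilon> q \<in> carr X"
        unfolding X_def by (rule ripple_in_X_space[OF h \<epsilon> H(1) D0 q])
      then have X0: "ripple h \<epsilon> q \<in> carr X\<^sub>0" by (simp add: X_def X\<^sub>0_def X_space_def X0_space_def)
      have n: "nrm X\<^sub>0 (ripple h \<epsilon> q) = sup_norm h (ripple h \<epsilon> q)"
        by (simp add: X\<^sub>0_def X0_space_def ripple_def A0)
      have "0 \<le> sup_norm h (ripple h \<epsilon> q)"
        using X h unfolding X_def by (intro sup_norm_nonneg C_spaceD(1)[OF X_spaceD(1)]) auto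
      then have "norm (DF \<phi> (ripple h \<epsilon> q)) \<le> \<bar>K\<bar> * sup_norm h (ripple h \<epsilon> q)"
        using K[OF X0] E(2)[OF X] n mult_right_mono[OF abs_ge_self[of K]] by fastforce
      also have "\<dots> \<le> \<bar>K\<bar> * (\<epsilon> * norm q)"
        using sup_norm_ripple[OF h \<epsilon>] by (intro mult_left_mono) auto
      also have "\<dots> \<le> 1 / 2 * norm q"
        using mult_right_mono[OF K\<epsilon> norm_ge_zero[of q]] by (simp add: mult.assoc)
      finally show ?thesis .
    qed
    moreover have "?\<Lambda> (ripple h \<epsilon> q) = q" for q
      using path_deriv_ripple[OF h \<epsilon>, of 0 q] h by (simp add: ripple_def A0)
    moreover have "ripple h \<epsilon> \<in> Lc (sub_nspace H) X"
      unfolding X_def by (rule ripple_in_Lc[where A = A, OF h \<epsilon> H(1) D0 A0])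
    ultimately show "\<exists>J\<in>Lc (sub_nspace H) X. \<exists>c. 0 \<le> c \<and> c < 1 \<and>
        (\<forall>q\<in>H. ?\<Lambda> (J q) = q \<and> norm (DF \<phi> (J q)) \<le> c * norm q)"
      by (intro bexI[of _ "ripple h \<epsilon>"] exI[of _ "1 / 2"]) auto
  qed
  then show ?thesis by (simp add: solution_manifold_def)
qed

end
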